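(* Let $\Omega\subseteq\mathbb{C}^n$ be a bounded domain, let $1\le p<q$ be integers, let $\mathcal{H}\in B_1^*(\Omega)$, and let $\Theta\in\mathcal{M}_{\mathcal{B}(\mathbb{C}^p,\mathbb{C}^q)}(\mathcal{H})$ be a left invertible multiplier. Let $\mathcal{H}_\Theta=(\mathcal{H}\otimes\mathbb{C}^q)/M_\Theta(\mathcal{H}\otimes\mathbb{C}^p)$ be the associated generalized canonical model. Then: (1) $\mathcal{H}_\Theta\in B_{q-p}^*(\Omega)$; and (2) $V_\Theta^*(\boldsymbol{w})=(\operatorname{ran}\Theta(\boldsymbol{w}))^\perp=\ker\Theta(\boldsymbol{w})^*$, $\boldsymbol{w}\in\Omega$, defines a hermitian anti-holomorphic vector bundle $V_\Theta^*=\coprod_{\boldsymbol{w}\in\Omega}V_\Theta^*(\boldsymbol{w})$ over $\Omega$ such that $$E^*_{\mathcal{H}_\Theta}\cong E^*_{\mathcal{H}}\otimes V_\Theta^*$$ (as hermitian anti-holomorphic vector bundles). In particular, if $q=p+1$ then $\mathcal{H}_\Theta\in B_1^*(\Omega)$ and $V_\Theta^*$ is a line bundle.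
   Context: All Hilbert spaces are complex and separable. A Hilbert module over $\mathbb{C}[\boldsymbol{z}]=\mathbb{C}[z_1,\dots,z_n]$ is a Hilbert space $\mathcal{H}$ with a commuting tuple $(M_1,\dots,M_n)$ of bounded operators, with action $p\cdot h=p(M_1,\dots,M_n)h$. If $\mathcal{S}$ is a submodule (closed jointly invariant subspace), the quotient module $\mathcal{H}/\mathcal{S}$ is identified with $\mathcal{S}^\perp$ with operators $P_{\mathcal{S}^\perp}M_i|_{\mathcal{S}^\perp}$. For a Hilbert space $\mathcal{E}$, $\mathcal{H}\otimes\mathcal{E}$ carries the operators $M_i\otimes I_{\mathcal{E}}$. For $m\ge1$, $B_m^*(\Omega)$ is the class of Hilbert modules $\mathcal{H}$ over $\mathbb{C}[\boldsymbol{z}]$ such that for every $\boldsymbol{w}\in\Omega$: (i) the column operator $\mathcal{H}\to\mathcal{H}\otimes\mathbb{C}^n$, $h\mapsto((M_1-w_1)^*h,\dots,(M_n-w_n)^*h)$, has closed range; (ii) $\dim\bigcap_{i=1}^n\ker(M_i-w_i)^*=m$; and (iii) $\bigvee_{\boldsymbol{w}\in\Omega}\bigcap_{i=1}^n\ker(M_i-w_i)^*=\mathcal{H}$. For $\mathcal{H}\in B_m^*(\Omega)$, $E_{\mathcal{H}}^*$ is the rank-$m$ hermitian anti-holomorphic vector bundle over $\Omega$ with fibers $E_{\mathcal{H}}^*(\boldsymbol{w})=\bigcap_i\ker(M_i-w_i)^*$ and the metric inherited from $\mathcal{H}$. For $\mathcal{H}\in B_1^*(\Omega)$ and Hilbert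 spaces $\mathcal{E},\mathcal{E}_*$, the multiplier space $\mathcal{M}_{\mathcal{B}(\mathcal{E},\mathcal{E}_* )}(\mathcal{H})$ consists of the holomorphic $\Theta:\Omega\to\mathcal{B}(\mathcal{E},\mathcal{E}_* )$ for which multiplication by $\Theta$ defines a bounded module map $M_\Theta:\mathcal{H}\otimes\mathcal{E}\to\mathcal{H}\otimes\mathcal{E}_*$; that is, $M_\Theta^*(k\otimes\eta)=k\otimes\Theta(\boldsymbol{w})^*\eta$ for all $\boldsymbol{w}\in\Omega$, $k\in E_{\mathcal{H}}^*(\boldsymbol{w})$, $\eta\in\mathcal{E}_*$. The multiplier $\Theta$ is left invertible if there is $\Psi\in\mathcal{M}_{\mathcal{B}(\mathcal{E}_*,\mathcal{E})}(\mathcal{H})$ with $\Psi(\boldsymbol{w})\Theta(\boldsymbol{w})=I_{\mathcal{E}}$ for all $\boldsymbol{w}\in\Omega$. The metric on $V_\Theta^*$ is inherited from $\mathbb{C}^q$. *)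

theory Defs
  imports "HOL-Analysis.Analysis"
begin

section \<open>Complex Hilbert spaces\<close>

text \<open>
  The norm and topology of a complex inner product space are those of the underlying real inner
  product space, whose inner product is the real part of the complex one. The complex inner
  product is linear in the first and conjugate-linear in the second argument.
\<close>

class complex_inner = real_inner +
  fixes scaleC :: "complex \<Rightarrow> 'a \<Rightarrow> 'a" (infixr "*\<^sub>C" 75)
    and cinner :: "'a \<Rightarrow> 'a \<Rightarrow> complex"
  assumes scaleC_of_real: "complex_of_real r *\<^sub>C x = r *\<^sub>R x"
    and scaleC_add_right: "a *\<^sub>C (x + y) = a *\<^sub>C x + a *\<^sub>C y"
    and scaleC_add_left: "(a + b) *\<^sub>C x = a *\<^sub>C x + b *\<^sub>C x"
    and scaleC_scaleC: "a *\<^sub>C (b *\<^sub>C x) = (a * b) *\<^sub>C x"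
    and scaleC_one: "1 *\<^sub>C x = x"
    and cinner_commute: "cinner x y = cnj (cinner y x)"
    and cinner_add_left: "cinner (x + y) z = cinner x z + cinner y z"
    and cinner_scaleC_left: "cinner (a *\<^sub>C x) y = a * cinner x y"
    and Re_cinner: "Re (cinner x y) = inner x y"

class chilbert_space = complex_inner + complete_space

global_interpretation cvec: vector_space "scaleC :: complex \<Rightarrow> 'a \<Rightarrow> 'a::complex_inner"
  by unfold_locales
    (simp_all add: scaleC_add_right scaleC_add_left scaleC_scaleC scaleC_one)

instantiation complex :: complex_inner
begin

definition scaleC_complex :: "complex \<Rightarrow> complex \<Rightarrow> complex"
  where "scaleC_complex a x = a * x"

definition cinner_complex :: "complex \<Rightarrow> complex \<Rightarrow> complex"
  where "cinner_complex x y = x * cnj y"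

instance
  by standard
    (auto simp: scaleC_complex_def cinner_complex_def inner_complex_def algebra_simps
      scaleR_conv_of_real)

end

instance complex :: chilbert_space ..

text \<open>
  For a Hilbert space \<open>H\<close> and a finite index type \<open>'q\<close>, the type \<open>H ^ 'q\<close> is the Hilbert
  space \<open>H \<otimes> \<complex>\<^sup>q\<close>; in particular \<open>complex ^ 'q\<close> is \<open>\<complex>\<^sup>q\<close>.
\<close>

instantiation vec :: (complex_inner, finite) complex_inner
begin

definition scaleC_vec :: "complex \<Rightarrow> 'a ^ 'b \<Rightarrow> 'a ^ 'b"
  where "scaleC_vec a x = (\<chi> i. a *\<^sub>C (x $ i))"

definition cinner_vec :: "'a ^ 'b \<Rightarrow> 'a ^ 'b \<Rightarrow> complex"
  where "cinner_vec x y = (\<Sum>i\<in>UNIV. cinner (x $ i) (y $ i))"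

instance
proof
  fix r :: real and a b :: complex and x y z :: "'a ^ 'b"
  show "complex_of_real r *\<^sub>C x = r *\<^sub>R x"
    by (simp add: scaleC_vec_def vec_eq_iff scaleC_of_real)
  show "a *\<^sub>C (x + y) = a *\<^sub>C x + a *\<^sub>C y"
    by (simp add: scaleC_vec_def vec_eq_iff scaleC_add_right)
  show "(a + b) *\<^sub>C x = a *\<^sub>C x + b *\<^sub>C x"
    by (simp add: scaleC_vec_def vec_eq_iff scaleC_add_left)
  show "a *\<^sub>C (b *\<^sub>C x) = (a * b) *\<^sub>C x"
    by (simp add: scaleC_vec_def vec_eq_iff scaleC_scaleC)
  show "1 *\<^sub>C x = x"
    by (simp add: scaleC_vec_def vec_eq_iff scaleC_one)
  show "cinner x y = cnj (cinner y x)"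
    unfolding cinner_vec_def cnj_sum by (rule sum.cong[OF refl], rule cinner_commute)
  show "cinner (x + y) z = cinner x z + cinner y z"
    by (simp add: cinner_vec_def cinner_add_left sum.distrib)
  show "cinner (a *\<^sub>C x) y = a * cinner x y"
    by (simp add: cinner_vec_def scaleC_vec_def cinner_scaleC_left sum_distrib_left)
  show "Re (cinner x y) = inner x y"
    by (simp add: cinner_vec_def inner_vec_def Re_cinner)
qed

end

instance vec :: (chilbert_space, finite) chilbert_space ..

definition tensor :: "'h::complex_inner \<Rightarrow> complex ^ 'q \<Rightarrow> 'h ^ 'q" (infixr "\<otimes>" 70)
  where "k \<otimes> \<eta> = (\<chi> j. (\<eta> $ j) *\<^sub>C k)"

lemma cinner_scaleC_right: "cinner x (a *\<^sub>C y) = cnj a * cinner x y"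
  by (metis cinner_commute cinner_scaleC_left complex_cnj_mult)

lemma cinner_tensor: "cinner (k \<otimes> \<eta>) (k' \<otimes> \<eta>') = cinner k k' * cinner \<eta> \<eta>'"
  by (simp add: tensor_def cinner_vec_def cinner_complex_def cinner_scaleC_left
      cinner_scaleC_right sum_distrib_left mult_ac)

text \<open>The operator \<open>T \<otimes> I\<close> on \<open>H \<otimes> \<complex>\<^sup>q\<close>.\<close>

definition ampliation :: "('h \<Rightarrow> 'h) \<Rightarrow> 'h ^ 'q \<Rightarrow> 'h ^ 'q"
  where "ampliation T x = (\<chi> j. T (x $ j))"

text \<open>
  Hilbert spaces that are not whole types are closed subspaces \<open>S\<close> of a type of class
  \<open>chilbert_space\<close>. An operator on \<open>S\<close> is a function on the ambient type of which only the
  values on \<open>S\<close> matter; in particular the adjoint \<open>hadjoint S T\<close> is that of \<open>T\<close> restricted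
  to \<open>S\<close>, with values in \<open>S\<close>.
\<close>

definition separable_set :: "'a::topological_space set \<Rightarrow> bool"
  where "separable_set S \<longleftrightarrow> (\<exists>D. countable D \<and> D \<subseteq> S \<and> S \<subseteq> closure D)"

definition bounded_op :: "'a::complex_inner set \<Rightarrow> ('a \<Rightarrow> 'b::complex_inner) \<Rightarrow> bool"
  where "bounded_op S T \<longleftrightarrow>
    (\<forall>x\<in>S. \<forall>y\<in>S. T (x + y) = T x + T y) \<and>
    (\<forall>a. \<forall>x\<in>S. T (a *\<^sub>C x) = a *\<^sub>C T x) \<and>
    (\<exists>B. \<forall>x\<in>S. norm (T x) \<le> B * norm x)"

definition hadjoint ::
    "'a::complex_inner set \<Rightarrow> ('a \<Rightarrow> 'b::complex_inner) \<Rightarrow> 'b \<Rightarrow> 'a"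
  where "hadjoint S T y = (THE z. z \<in> S \<and> (\<forall>x\<in>S. cinner (T x) y = cinner x z))"

definition orth :: "'a::complex_inner set \<Rightarrow> 'a set"
  where "orth S = {x. \<forall>y\<in>S. cinner x y = 0}"

definition orth_proj :: "'a::complex_inner set \<Rightarrow> 'a \<Rightarrow> 'a"
  where "orth_proj S x = (THE y. y \<in> S \<and> x - y \<in> orth S)"


section \<open>Hilbert modules and the classes \<open>B\<^sub>m\<^sup>*(\<Omega>)\<close>\<close>

text \<open>The coordinate functions act on \<open>S\<close> by the tuple \<open>M\<close>.\<close>

definition hilbert_module :: "'h::chilbert_space set \<Rightarrow> ('n \<Rightarrow> 'h \<Rightarrow> 'h) \<Rightarrow> bool"
  where "hilbert_module S M \<longleftrightarrow>
    cvec.subspace S \<and> closed S \<and> separable_set S \<and>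
    (\<forall>i. M i ` S \<subseteq> S \<and> bounded_op S (M i)) \<and>
    (\<forall>i j. \<forall>x\<in>S. M i (M j x) = M j (M i x))"

definition column_op ::
    "'h::chilbert_space set \<Rightarrow> ('n::finite \<Rightarrow> 'h \<Rightarrow> 'h) \<Rightarrow> complex ^ 'n \<Rightarrow> 'h \<Rightarrow> 'h ^ 'n"
  where "column_op S M w h = (\<chi> i. hadjoint S (\<lambda>x. M i x - (w $ i) *\<^sub>C x) h)"

definition eigen_bundle ::
    "'h::chilbert_space set \<Rightarrow> ('n::finite \<Rightarrow> 'h \<Rightarrow> 'h) \<Rightarrow> complex ^ 'n \<Rightarrow> 'h set"
  where "eigen_bundle S M w =
    {h \<in> S. \<forall>i. hadjoint S (\<lambda>x. M i x - (w $ i) *\<^sub>C x) h = 0}"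

text \<open>
  \<open>cvec.dim\<close> is \<open>0\<close> on infinite-dimensional subspaces, so for \<open>m \<ge> 1\<close> the condition
  \<open>cvec.dim E = m\<close> includes finite-dimensionality.
\<close>

definition B_star ::
    "nat \<Rightarrow> (complex ^ 'n) set \<Rightarrow> 'h::chilbert_space set \<Rightarrow> ('n::finite \<Rightarrow> 'h \<Rightarrow> 'h) \<Rightarrow> bool"
  where "B_star m \<Omega> S M \<longleftrightarrow>
    1 \<le> m \<and> hilbert_module S M \<and>
    (\<forall>w\<in>\<Omega>. closed (column_op S M w ` S) \<and> cvec.dim (eigen_bundle S M w) = m) \<and>
    closure (cvec.span (\<Union>w\<in>\<Omega>. eigen_bundle S M w)) = S"


section \<open>Hermitian anti-holomorphic vector bundles\<close>

definition holomorphic_map ::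
    "(complex ^ 'n) set \<Rightarrow> (complex ^ 'n \<Rightarrow> 'v::complex_inner) \<Rightarrow> bool"
  where "holomorphic_map U f \<longleftrightarrow>
    (\<forall>w\<in>U. \<exists>D. (f has_derivative D) (at w) \<and> (\<forall>a v. D (a *\<^sub>C v) = a *\<^sub>C D v))"

definition antiholomorphic_map ::
    "(complex ^ 'n) set \<Rightarrow> (complex ^ 'n \<Rightarrow> 'v::complex_inner) \<Rightarrow> bool"
  where "antiholomorphic_map U f \<longleftrightarrow>
    (\<forall>w\<in>U. \<exists>D. (f has_derivative D) (at w) \<and> (\<forall>a v. D (a *\<^sub>C v) = cnj a *\<^sub>C D v))"

text \<open>
  All bundles considered are given as subbundles of a trivial bundle \<open>\<Omega> \<times> V\<close> with \<open>V\<close> a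
  Hilbert space: a bundle is the family of its fibers \<open>E w \<subseteq> V\<close>, it carries the metric
  inherited from \<open>V\<close>, and its anti-holomorphic sections are the anti-holomorphic \<open>V\<close>-valued
  maps with values in the fibers. Local triviality is the existence of local anti-holomorphic
  frames.
\<close>

definition antiholomorphic_section ::
    "(complex ^ 'n) set \<Rightarrow> (complex ^ 'n \<Rightarrow> 'v::complex_inner set) \<Rightarrow>
      (complex ^ 'n \<Rightarrow> 'v) \<Rightarrow> bool"
  where "antiholomorphic_section U E s \<longleftrightarrow> (\<forall>w\<in>U. s w \<in> E w) \<and> antiholomorphic_map U s"

definition antiholomorphic_bundle ::
    "nat \<Rightarrow> (complex ^ 'n) set \<Rightarrow> (complex ^ 'n \<Rightarrow> 'v::complex_inner set) \<Rightarrow> bool"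
  where "antiholomorphic_bundle m \<Omega> E \<longleftrightarrow>
    (\<forall>w\<in>\<Omega>. cvec.subspace (E w)) \<and>
    (\<forall>w0\<in>\<Omega>. \<exists>U s. open U \<and> w0 \<in> U \<and> U \<subseteq> \<Omega> \<and>
      (\<forall>j<m. antiholomorphic_section U E (s j)) \<and>
      (\<forall>w\<in>U. inj_on (\<lambda>j. s j w) {..<m} \<and> cvec.independent ((\<lambda>j. s j w) ` {..<m}) \<and>
        cvec.span ((\<lambda>j. s j w) ` {..<m}) = E w))"

definition bundle_iso ::
    "(complex ^ 'n) set \<Rightarrow> (complex ^ 'n \<Rightarrow> 'v::complex_inner set) \<Rightarrow>
      (complex ^ 'n \<Rightarrow> 'u::complex_inner set) \<Rightarrow> bool"
  where "bundle_iso \<Omega> E F \<longleftrightarrow>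
    (\<exists>m. antiholomorphic_bundle m \<Omega> E \<and> antiholomorphic_bundle m \<Omega> F) \<and>
    (\<exists>\<phi>. (\<forall>w\<in>\<Omega>. bij_betw (\<phi> w) (E w) (F w) \<and>
        (\<forall>x\<in>E w. \<forall>y\<in>E w. \<phi> w (x + y) = \<phi> w x + \<phi> w y) \<and>
        (\<forall>a. \<forall>x\<in>E w. \<phi> w (a *\<^sub>C x) = a *\<^sub>C \<phi> w x) \<and>
        (\<forall>x\<in>E w. \<forall>y\<in>E w. cinner (\<phi> w x) (\<phi> w y) = cinner x y)) \<and>
      (\<forall>U s. open U \<and> U \<subseteq> \<Omega> \<and> (\<forall>w\<in>U. s w \<in> E w) \<longrightarrow>
        (antiholomorphic_section U E s \<longleftrightarrow> antiholomorphic_section U F (\<lambda>w. \<phi> w (s w)))))"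

text \<open>
  The tensor product of \<open>E \<subseteq> \<Omega> \<times> H\<close> and \<open>F \<subseteq> \<Omega> \<times> \<complex>\<^sup>q\<close>, as a subbundle of
  \<open>\<Omega> \<times> (H \<otimes> \<complex>\<^sup>q)\<close>. By \<open>cinner_tensor\<close> the inherited metric is the tensor product
  metric.
\<close>

definition tensor_bundle ::
    "(complex ^ 'n \<Rightarrow> 'h::complex_inner set) \<Rightarrow> (complex ^ 'n \<Rightarrow> (complex ^ 'q) set) \<Rightarrow>
      complex ^ 'n \<Rightarrow> ('h ^ 'q) set"
  where "tensor_bundle E F w = cvec.span {k \<otimes> \<eta> |k \<eta>. k \<in> E w \<and> \<eta> \<in> F w}"


section \<open>Multipliers and generalized canonical models\<close>

text \<open>
  The Hilbert module is here the whole type \<open>'h\<close> with the tuple \<open>M\<close>, and the operators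
  \<open>\<Theta>(w) : \<complex>\<^sup>p \<rightarrow> \<complex>\<^sup>q\<close> are given by their matrices. \<open>is_mult_op \<Omega> M \<Theta> T\<close> says that \<open>T\<close> is
  the operator \<open>M\<^sub>\<Theta> : H \<otimes> \<complex>\<^sup>p \<rightarrow> H \<otimes> \<complex>\<^sup>q\<close>.
\<close>

definition is_mult_op ::
    "(complex ^ 'n) set \<Rightarrow> ('n::finite \<Rightarrow> 'h::chilbert_space \<Rightarrow> 'h) \<Rightarrow>
      (complex ^ 'n \<Rightarrow> complex ^ 'p ^ 'q) \<Rightarrow> ('h ^ 'p \<Rightarrow> 'h ^ 'q) \<Rightarrow> bool"
  where "is_mult_op \<Omega> M \<Theta> T \<longleftrightarrow>
    bounded_op UNIV T \<and>
    (\<forall>i x. T (ampliation (M i) x) = ampliation (M i) (T x)) \<and>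
    (\<forall>w\<in>\<Omega>. \<forall>k\<in>eigen_bundle UNIV M w. \<forall>\<eta>.
      hadjoint UNIV T (k \<otimes> \<eta>) = k \<otimes> hadjoint UNIV ((*v) (\<Theta> w)) \<eta>)"

definition multiplier ::
    "(complex ^ 'n) set \<Rightarrow> ('n::finite \<Rightarrow> 'h::chilbert_space \<Rightarrow> 'h) \<Rightarrow>
      (complex ^ 'n \<Rightarrow> complex ^ 'p ^ 'q) \<Rightarrow> bool"
  where "multiplier \<Omega> M \<Theta> \<longleftrightarrow> holomorphic_map \<Omega> \<Theta> \<and> (\<exists>T. is_mult_op \<Omega> M \<Theta> T)"

definition mult_op ::
    "(complex ^ 'n) set \<Rightarrow> ('n::finite \<Rightarrow> 'h::chilbert_space \<Rightarrow> 'h) \<Rightarrow>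
      (complex ^ 'n \<Rightarrow> complex ^ 'p ^ 'q) \<Rightarrow> 'h ^ 'p \<Rightarrow> 'h ^ 'q"
  where "mult_op \<Omega> M \<Theta> = (THE T. is_mult_op \<Omega> M \<Theta> T)"

definition left_invertible_multiplier ::
    "(complex ^ 'n) set \<Rightarrow> ('n::finite \<Rightarrow> 'h::chilbert_space \<Rightarrow> 'h) \<Rightarrow>
      (complex ^ 'n \<Rightarrow> complex ^ 'p ^ 'q) \<Rightarrow> bool"
  where "left_invertible_multiplier \<Omega> M \<Theta> \<longleftrightarrow>
    multiplier \<Omega> M \<Theta> \<and>
    (\<exists>\<Psi> :: complex ^ 'n \<Rightarrow> complex ^ 'q ^ 'p.
      multiplier \<Omega> M \<Psi> \<and> (\<forall>w\<in>\<Omega>. \<Psi> w ** \<Theta> w = mat 1))"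

text \<open>
  The model \<open>(H \<otimes> \<complex>\<^sup>q) / M\<^sub>\<Theta>(H \<otimes> \<complex>\<^sup>p)\<close>, realized on the orthogonal complement of the
  submodule with the compressed operators.
\<close>

definition model_space ::
    "(complex ^ 'n) set \<Rightarrow> ('n::finite \<Rightarrow> 'h::chilbert_space \<Rightarrow> 'h) \<Rightarrow>
      (complex ^ 'n \<Rightarrow> complex ^ 'p ^ 'q) \<Rightarrow> ('h ^ 'q) set"
  where "model_space \<Omega> M \<Theta> = orth (range (mult_op \<Omega> M \<Theta>))"

definition model_op ::
    "(complex ^ 'n) set \<Rightarrow> ('n::finite \<Rightarrow> 'h::chilbert_space \<Rightarrow> 'h) \<Rightarrow>
      (complex ^ 'n \<Rightarrow> complex ^ 'p ^ 'q) \<Rightarrow> 'n \<Rightarrow> 'h ^ 'q \<Rightarrow> 'h ^ 'q"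
  where "model_op \<Omega> M \<Theta> i x = orth_proj (model_space \<Omega> M \<Theta>) (ampliation (M i) x)"

definition V_bundle :: "(complex ^ 'n \<Rightarrow> complex ^ 'p ^ 'q) \<Rightarrow> complex ^ 'n \<Rightarrow> (complex ^ 'q) set"
  where "V_bundle \<Theta> w = orth (range ((*v) (\<Theta> w)))"

end

theory Submission
  imports Defs
begin

text \<open>
  The adjoint of \<open>M\<^sub>\<Theta>\<close> sends \<open>k \<otimes> \<eta>\<close> to \<open>k \<otimes> \<Theta>(w)\<^sup>*\<eta>\<close> for \<open>k\<close> in the fiber \<open>E(w)\<close> of \<open>E\<^sub>H\<^sup>*\<close>.
  Hence the joint eigenspace at \<open>w\<close> of the adjoints of the compressed tuple, which is the part of
  \<open>E(w) \<otimes> \<complex>\<^sup>q\<close> in \<open>ker M\<^sub>\<Theta>\<^sup>*\<close>, is exactly \<open>E(w) \<otimes> V\<^sub>\<Theta>\<^sup>*(w)\<close>, and the bundle isomorphism is the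
  identity. A left inverse \<open>\<Psi>\<close> yields the idempotent \<open>I - M\<^sub>\<Psi>\<^sup>* M\<^sub>\<Theta>\<^sup>*\<close> onto \<open>ker M\<^sub>\<Theta>\<^sup>*\<close>, which commutes with
  the operators \<open>M\<^sub>i\<^sup>* \<otimes> I\<close> and so carries totality of the eigenvectors and closedness of ranges over from
  \<open>H \<otimes> \<complex>\<^sup>q\<close>; its fibers \<open>I - \<Psi>(w)\<^sup>* \<Theta>(w)\<^sup>*\<close> provide local frames of \<open>V\<^sub>\<Theta>\<^sup>*\<close>. For \<open>E\<^sub>H\<^sup>*\<close>, the closed
  range makes the column operator bounded below on the complement of its kernel, locally uniformly
  in \<open>w\<close>, and then a suitably normalized eigenvector depends anti-holomorphically on \<open>w\<close>.
\<close>

section \<open>Complex inner products\<close>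

lemma cinner_add_right: "cinner x (y + z) = cinner x y + cinner x z"
  by (metis cinner_add_left cinner_commute complex_cnj_add)

lemma cinner_zero_left [simp]: "cinner 0 x = 0"
  using cinner_add_left[of 0 0 x] by simp

lemma cinner_zero_right [simp]: "cinner x 0 = 0"
  using cinner_add_right[of x 0 0] by simp

lemma cinner_minus_left [simp]: "cinner (- x) y = - cinner x y"
  using cinner_add_left[of x "- x" y] by (simp add: add_eq_0_iff)

lemma cinner_minus_right [simp]: "cinner x (- y) = - cinner x y"
  using cinner_add_right[of x y "- y"] by (simp add: add_eq_0_iff)

lemma cinner_diff_left: "cinner (x - y) z = cinner x z - cinner y z"
  using cinner_add_left[of x "- y" z] by simp

lemma cinner_diff_right: "cinner x (y - z) = cinner x y - cinner x z"
  using cinner_add_right[of x y "- z"] by simp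

lemma cinner_scaleR_left: "cinner (r *\<^sub>R x) y = of_real r * cinner x y"
  by (simp flip: scaleC_of_real add: cinner_scaleC_left)

lemma cinner_scaleR_right: "cinner x (r *\<^sub>R y) = of_real r * cinner x y"
  by (simp flip: scaleC_of_real add: cinner_scaleC_right)

lemma Im_cinner: "Im (cinner x y) = inner x (\<i> *\<^sub>C y)"
  by (simp flip: Re_cinner add: cinner_scaleC_right)

text \<open>The imaginary part of the pairing is the real pairing against
  \<open>\<i> *\<^sub>C y\<close>. This lets the real Riesz representation serve for complex
  adjoints.\<close>

lemma cinner_eq_iff_inner:
  "cinner x y = cinner z w \<longleftrightarrow> inner x y = inner z w \<and> inner x (\<i> *\<^sub>C y) = inner z (\<i> *\<^sub>C w)"
  by (simp add: complex_eq_iff Re_cinner Im_cinner)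

lemma cinner_eq_zero_iff [simp]: "cinner x x = 0 \<longleftrightarrow> x = 0"
  by (metis Re_cinner cinner_zero_left inner_eq_zero_iff zero_complex.simps(1))

lemma cinner_ext: "(\<And>x. cinner x y = cinner x z) \<Longrightarrow> y = z"
  by (metis cinner_diff_right cinner_eq_zero_iff eq_iff_diff_eq_0)

lemma cinner_self: "cinner x x = of_real ((norm x)\<^sup>2)"
proof -
  have "Im (cinner x x) = 0"
    using cinner_commute[of x x] by (simp add: complex_eq_iff)
  then show ?thesis
    by (simp add: complex_eq_iff Re_cinner power2_norm_eq_inner)
qed

lemma norm_scaleC [simp]: "norm (a *\<^sub>C x) = cmod a * norm x"
proof -
  have "of_real ((norm (a *\<^sub>C x))\<^sup>2) = (a * cnj a) * of_real ((norm x)\<^sup>2)"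
    by (simp only: cinner_self[symmetric] cinner_scaleC_left cinner_scaleC_right mult_ac)
  also have "\<dots> = of_real ((cmod a * norm x)\<^sup>2)"
    by (simp add: complex_norm_square[symmetric] power_mult_distrib)
  finally have "(norm (a *\<^sub>C x))\<^sup>2 = (cmod a * norm x)\<^sup>2"
    using of_real_eq_iff by blast
  then show ?thesis
    by (simp add: power2_eq_iff_nonneg)
qed

lemma bounded_bilinear_scaleC: "bounded_bilinear (\<lambda>a x. a *\<^sub>C x)"
proof
  fix a b :: complex and x y :: 'a and r :: real
  show "(a + b) *\<^sub>C x = a *\<^sub>C x + b *\<^sub>C x" "a *\<^sub>C (x + y) = a *\<^sub>C x + a *\<^sub>C y"
    by (fact scaleC_add_left scaleC_add_right)+
  show "(r *\<^sub>R a) *\<^sub>C x = r *\<^sub>R (a *\<^sub>C x)" "a *\<^sub>C (r *\<^sub>R x) = r *\<^sub>R (a *\<^sub>C x)"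
    by (simp_all flip: scaleC_of_real add: scaleC_scaleC scaleR_conv_of_real scaleC_complex_def mult.commute)
  show "\<exists>K. \<forall>a (x::'a). norm (a *\<^sub>C x) \<le> norm a * norm x * K"
    by (rule exI[of _ 1]) simp
qed

text \<open>Multiplying \<open>x\<close> by a phase makes the pairing real and nonnegative, which
  reduces the bound to the real Cauchy-Schwarz inequality.\<close>

lemma cmod_cinner_le: "cmod (cinner x y) \<le> norm x * norm y"
proof (cases "cinner x y = 0")
  case False
  define u where "u = cnj (cinner x y) / of_real (cmod (cinner x y))"
  have u: "cmod u = 1"
    using False by (simp add: u_def norm_divide)
  have "cinner (u *\<^sub>C x) y = of_real (cmod (cinner x y))"
    using False by (simp add: u_def cinner_scaleC_left mult.commute[of "cnj _"] flip: complex_norm_square)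
      (simp add: power2_eq_square)
  then have "cmod (cinner x y) = inner (u *\<^sub>C x) y"
    by (metis Re_cinner Re_complex_of_real)
  also have "\<dots> \<le> norm (u *\<^sub>C x) * norm y"
    by (rule norm_cauchy_schwarz)
  finally show ?thesis
    by (simp add: u)
qed simp

lemma bounded_bilinear_cinner: "bounded_bilinear cinner"
proof
  show "\<exists>K. \<forall>x y :: 'a. norm (cinner x y) \<le> norm x * norm y * K"
    by (rule exI[of _ 1]) (simp add: cmod_cinner_le)
qed (simp_all add: cinner_add_left cinner_add_right cinner_scaleR_left cinner_scaleR_right
    scaleR_conv_of_real)

lemmas continuous_on_cinner [continuous_intros] = bounded_bilinear.continuous_on[OF bounded_bilinear_cinner]

lemma bounded_linear_scaleC: "bounded_linear (\<lambda>x. a *\<^sub>C x)"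
  by (rule bounded_bilinear.bounded_linear_right[OF bounded_bilinear_scaleC])

lemma subspace_if_csubspace: "cvec.subspace S \<Longrightarrow> subspace S"
  unfolding cvec.subspace_def subspace_def by (metis scaleC_of_real)

lemma csubspace_orth: "cvec.subspace (orth S)"
  by (auto simp: cvec.subspace_def orth_def cinner_add_left cinner_scaleC_left)

lemma closed_orth: "closed (orth S)"
proof -
  have "orth S = (\<Inter>y\<in>S. {x. cinner x y = 0})"
    by (auto simp: orth_def)
  also have "closed \<dots>"
    by (intro closed_INT ballI closed_Collect_eq continuous_intros)
  finally show ?thesis .
qed

section \<open>Orthogonal projections and adjoints\<close>

text \<open>A minimizing sequence is Cauchy by the parallelogram law.\<close>

lemma orthogonal_projection_exists:
  fixes S :: "'a::{real_inner, complete_space} set"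
  assumes S: "subspace S" and "closed S"
  shows "\<exists>y\<in>S. \<forall>z\<in>S. inner (x - y) z = 0"
proof -
  define d where "d = infdist x S"
  have ne: "S \<noteq> {}"
    using S subspace_0 by blast
  have d_le: "d \<le> norm (x - y)" if "y \<in> S" for y
    using infdist_le[OF that, of x] by (simp add: d_def dist_norm)
  have "\<exists>y\<in>S. norm (x - y) < d + inverse (Suc n)" for n
  proof (rule ccontr)
    assume "\<not> ?thesis"
    then have "d + inverse (Suc n) \<le> norm (x - y)" if "y \<in> S" for y
      using that by (meson not_less)
    then have "d + inverse (Suc n) \<le> infdist x S"
      unfolding infdist_notempty[OF ne] dist_norm by (intro cINF_greatest ne)
    then show False by (simp add: d_def)
  qed
  then obtain y where yS: "\<And>n. y n \<in> S" and y: "\<And>n. norm (x - y n) < d + inverse (Suc n)"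
    by metis
  have lim: "(\<lambda>n. norm (x - y n)) \<longlonglongrightarrow> d"
  proof (rule tendsto_sandwich[OF _ _ tendsto_const])
    show "(\<lambda>n. d + inverse (Suc n)) \<longlonglongrightarrow> d"
      using tendsto_add[OF tendsto_const LIMSEQ_inverse_real_of_nat, of d] by simp
  qed (use y d_le yS in \<open>auto intro!: always_eventually less_imp_le\<close>)
  \<comment> \<open>Parallelogram law for \<open>x - y m\<close> and \<open>x - y n\<close>; the
    term \<open>4 * d\<^sup>2\<close> comes from the midpoint of \<open>y m\<close> and
    \<open>y n\<close>, which lies in \<open>S\<close>.\<close>
  have par: "(norm (y m - y n))\<^sup>2 \<le> 2 * (norm (x - y m))\<^sup>2 + 2 * (norm (x - y n))\<^sup>2 - 4 * d\<^sup>2" for m n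
  proof -
    have "d \<le> norm (x - (1/2) *\<^sub>R (y m + y n))"
      by (intro d_le subspace_scale[OF S] subspace_add[OF S] yS)
    moreover have "0 \<le> d"
      by (simp add: d_def infdist_nonneg)
    ultimately have "d\<^sup>2 \<le> (norm (x - (1/2) *\<^sub>R (y m + y n)))\<^sup>2"
      by (rule power_mono)
    then show ?thesis
      unfolding power2_norm_eq_inner
      by (simp add: inner_diff_left inner_diff_right inner_add_left inner_add_right inner_commute field_simps)
  qed
  have "Cauchy y"
  proof (rule metric_CauchyI)
    fix e :: real assume "e > 0"
    have "(\<lambda>n. 2 * (norm (x - y n))\<^sup>2) \<longlonglongrightarrow> 2 * d\<^sup>2"
      by (intro tendsto_intros lim)
    then have "\<forall>\<^sub>F n in sequentially. 2 * (norm (x - y n))\<^sup>2 < 2 * d\<^sup>2 + e\<^sup>2 / 2"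
      by (rule order_tendstoD) (use \<open>e > 0\<close> in simp)
    then obtain N where N: "\<And>n. n \<ge> N \<Longrightarrow> 2 * (norm (x - y n))\<^sup>2 < 2 * d\<^sup>2 + e\<^sup>2 / 2"
      by (auto simp: eventually_sequentially)
    have "dist (y m) (y n) < e" if "m \<ge> N" "n \<ge> N" for m n
    proof -
      have "(norm (y m - y n))\<^sup>2 < e\<^sup>2"
        using par[of m n] N[OF that(1)] N[OF that(2)] by argo
      then show ?thesis
        using \<open>e > 0\<close> by (simp add: dist_norm power_less_imp_less_base)
    qed
    then show "\<exists>N. \<forall>m\<ge>N. \<forall>n\<ge>N. dist (y m) (y n) < e" by blast
  qed
  then obtain p where p: "y \<longlonglongrightarrow> p"
    using Cauchy_convergent convergent_def by blast
  have pS: "p \<in> S"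
    using closed_sequentially[OF \<open>closed S\<close>] yS p by blast
  have "(\<lambda>n. norm (x - y n)) \<longlonglongrightarrow> norm (x - p)"
    by (intro tendsto_intros p)
  then have np: "norm (x - p) = d"
    using lim LIMSEQ_unique by blast
  have "inner (x - p) z = 0" if z: "z \<in> S" "z \<noteq> 0" for z
  proof -
    \<comment> \<open>The minimizer of the squared distance from \<open>x\<close> along the line
      through \<open>p\<close> in direction \<open>z\<close>.\<close>
    define t where "t = inner (x - p) z / inner z z"
    have "d \<le> norm (x - (p + t *\<^sub>R z))"
      by (intro d_le subspace_scale[OF S] subspace_add[OF S] pS z)
    then have "(norm (x - p))\<^sup>2 \<le> (norm ((x - p) - t *\<^sub>R z))\<^sup>2"
      by (intro power_mono) (simp_all add: np[symmetric] algebra_simps)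
    also have "\<dots> = (norm (x - p))\<^sup>2 - 2 * t * inner (x - p) z + t\<^sup>2 * inner z z"
      unfolding power2_norm_eq_inner
      by (simp add: inner_diff_left inner_diff_right inner_commute power2_eq_square algebra_simps)
    also have "\<dots> = (norm (x - p))\<^sup>2 - (inner (x - p) z)\<^sup>2 / inner z z"
      using z by (simp add: t_def power2_eq_square)
    finally have "(inner (x - p) z)\<^sup>2 / inner z z \<le> 0" by simp
    moreover have "inner z z > 0" using z by simp
    ultimately show ?thesis
      by (simp add: divide_le_0_iff)
  qed
  then show ?thesis
    using pS by (metis inner_zero_right)
qed

section \<open>Riesz representation, adjoints and projections\<close>

lemma riesz_representation_exists:
  fixes f :: "'a::{real_inner, complete_space} \<Rightarrow> real"
  assumes "bounded_linear f"
  shows "\<exists>z. \<forall>x. f x = inner x z"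
proof (cases "\<forall>x. f x = 0")
  case True
  then show ?thesis by (intro exI[of _ 0]) simp
next
  case False
  interpret f: bounded_linear f by fact
  obtain x0 where x0: "f x0 \<noteq> 0" using False by blast
  have "subspace {x. f x = 0}"
    by (auto simp: subspace_def f.add f.scaleR)
  moreover have "closed {x. f x = 0}"
    by (intro closed_Collect_eq continuous_intros f.continuous_on)
  ultimately obtain y where y: "f y = 0" and orth: "\<And>z. f z = 0 \<Longrightarrow> inner (x0 - y) z = 0"
    using orthogonal_projection_exists[of "{x. f x = 0}" x0] by auto
  \<comment> \<open>The kernel of \<open>f\<close> has codimension one, so its complement is spanned
    by \<open>u\<close> and the representing vector is a multiple of \<open>u\<close>.\<close>
  define u where "u = x0 - y"
  have fu: "f u \<noteq> 0"
    using x0 y by (simp add: u_def f.diff)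
  then have u: "inner u u \<noteq> 0"
    using f.zero by auto
  have "f x = inner x ((f u / inner u u) *\<^sub>R u)" for x
  proof -
    have "f (x - (f x / f u) *\<^sub>R u) = 0"
      using fu by (simp add: f.diff f.scaleR)
    then have "inner u (x - (f x / f u) *\<^sub>R u) = 0"
      unfolding u_def by (rule orth)
    then have "inner x u = (f x / f u) * inner u u"
      by (simp add: inner_diff_right inner_commute)
    then show ?thesis
      using u fu by simp
  qed
  then show ?thesis by blast
qed

text \<open>Complex scalars restrict to real ones, so the theory of \<open>bounded_linear\<close>
  becomes available for operators on a whole space.\<close>

lemma bounded_op_UNIV_iff:
  "bounded_op UNIV T \<longleftrightarrow> bounded_linear T \<and> (\<forall>a x. T (a *\<^sub>C x) = a *\<^sub>C T x)"
proof
  assume T: "bounded_op UNIV T"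
  then obtain B where B: "\<And>x. norm (T x) \<le> B * norm x"
    by (auto simp: bounded_op_def)
  have "bounded_linear T"
  proof (rule bounded_linear_intro)
    show "T (r *\<^sub>R x) = r *\<^sub>R T x" for r x
      using T unfolding bounded_op_def by (metis UNIV_I scaleC_of_real)
    show "norm (T x) \<le> norm x * B" for x
      using B by (simp add: mult.commute)
  qed (use T in \<open>auto simp: bounded_op_def\<close>)
  then show "bounded_linear T \<and> (\<forall>a x. T (a *\<^sub>C x) = a *\<^sub>C T x)"
    using T by (auto simp: bounded_op_def)
next
  assume "bounded_linear T \<and> (\<forall>a x. T (a *\<^sub>C x) = a *\<^sub>C T x)"
  then interpret bounded_linear T by simp
  show "bounded_op UNIV T"
    using \<open>bounded_linear T \<and> _\<close> bounded by (auto simp: bounded_op_def add mult.commute)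
qed

text \<open>Two candidates in \<open>S\<close> differ by an element of \<open>S\<close> that is
  orthogonal to itself. The explicit adjoints below are all found by checking this pairing.\<close>

lemma hadjoint_eqI:
  assumes "cvec.subspace S" "z \<in> S" "\<And>x. x \<in> S \<Longrightarrow> cinner (T x) y = cinner x z"
  shows "hadjoint S T y = z"
  unfolding hadjoint_def
proof (rule the_equality)
  fix z' assume z': "z' \<in> S \<and> (\<forall>x\<in>S. cinner (T x) y = cinner x z')"
  then have "z' - z \<in> S"
    using assms by (simp add: cvec.subspace_diff)
  then have "cinner (z' - z) (z' - z) = 0"
    using assms(3) z' by (simp add: cinner_diff_right)
  then show "z' = z" by simp
qed (use assms in auto)

lemma cinner_hadjoint:
  fixes T :: "'a::chilbert_space \<Rightarrow> 'b::complex_inner"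
  assumes "bounded_op UNIV T"
  shows "cinner (T x) y = cinner x (hadjoint UNIV T y)"
proof -
  have T: "bounded_linear T" "\<And>a x. T (a *\<^sub>C x) = a *\<^sub>C T x"
    using assms by (auto simp: bounded_op_UNIV_iff)
  have "bounded_linear (\<lambda>x. inner (T x) y)"
    by (rule bounded_linear_compose[OF bounded_linear_inner_left T(1)])
  then obtain z where z: "\<And>x. inner (T x) y = inner x z"
    using riesz_representation_exists by blast
  \<comment> \<open>Since \<open>T\<close> is complex linear, this rotation turns the imaginary part
    of the pairing into a real pairing, so the real representing vector \<open>z\<close> also
    represents the complex functional.\<close>
  have rot: "inner x' (\<i> *\<^sub>C y') = inner ((- \<i>) *\<^sub>C x') y'" for x' y' :: "'c::complex_inner"
    by (simp flip: Re_cinner add: cinner_scaleC_left cinner_scaleC_right del: mult_minus_left)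
  have *: "cinner (T x) y = cinner x z" for x
    unfolding cinner_eq_iff_inner rot T(2)[symmetric] z by simp
  have "hadjoint UNIV T y = z"
    by (rule hadjoint_eqI) (auto simp: * cvec.subspace_def)
  then show ?thesis
    using * by simp
qed

text \<open>Pairing \<open>?A y\<close> with itself and moving one factor over to \<open>T\<close>
  shows that a bound for \<open>T\<close> also bounds the adjoint. Linearity is seen by testing
  against all vectors.\<close>

lemma bounded_op_hadjoint:
  fixes T :: "'a::chilbert_space \<Rightarrow> 'b::complex_inner"
  assumes T: "bounded_op UNIV T"
  shows "bounded_op UNIV (hadjoint UNIV T)"
proof -
  obtain B where B: "0 \<le> B" "\<And>x. norm (T x) \<le> norm x * B"
    using T bounded_linear.nonneg_bounded bounded_op_UNIV_iff by metis
  let ?A = "hadjoint UNIV T"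
  have "norm (?A y) \<le> B * norm y" for y
  proof (cases "?A y = 0")
    case True
    then show ?thesis using B(1) by simp
  next
    case False
    have "(norm (?A y))\<^sup>2 = inner (T (?A y)) y"
      by (simp add: power2_norm_eq_inner cinner_hadjoint[OF T] flip: Re_cinner)
    also have "\<dots> \<le> norm (T (?A y)) * norm y"
      by (rule norm_cauchy_schwarz)
    also have "\<dots> \<le> norm (?A y) * B * norm y"
      by (intro mult_right_mono B) simp
    finally show ?thesis
      using False by (simp add: power2_eq_square mult_ac)
  qed
  moreover have "?A (x + y) = ?A x + ?A y" for x y
    by (rule cinner_ext) (simp flip: cinner_hadjoint[OF T] add: cinner_add_right)
  moreover have "?A (a *\<^sub>C y) = a *\<^sub>C ?A y" for a y
    by (rule cinner_ext) (simp flip: cinner_hadjoint[OF T] add: cinner_scaleC_right)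
  ultimately show ?thesis
    unfolding bounded_op_def by blast
qed

lemma orth_proj_properties:
  fixes S :: "'a::chilbert_space set"
  assumes S: "cvec.subspace S" "closed S"
  shows "orth_proj S x \<in> S" "x - orth_proj S x \<in> orth S"
proof -
  obtain y where y: "y \<in> S" and o: "\<And>z. z \<in> S \<Longrightarrow> inner (x - y) z = 0"
    using orthogonal_projection_exists[OF subspace_if_csubspace[OF S(1)] S(2), of x] by blast
  \<comment> \<open>\<open>S\<close> is stable under multiplication by \<open>\<i>\<close>, so real
    orthogonality to \<open>S\<close> is already complex orthogonality.\<close>
  have "x - y \<in> orth S"
    using o cvec.subspace_scale[OF S(1)]
    by (simp add: orth_def complex_eq_iff Re_cinner Im_cinner)
  moreover have "y' = y" if "y' \<in> S \<and> x - y' \<in> orth S" for y'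
  proof -
    have "(x - y) - (x - y') \<in> orth S"
      using that \<open>x - y \<in> orth S\<close> by (blast intro: cvec.subspace_diff[OF csubspace_orth])
    moreover have "y' - y \<in> S"
      using that y S(1) by (intro cvec.subspace_diff) auto
    ultimately have "cinner (y' - y) (y' - y) = 0"
      by (simp add: orth_def)
    then show ?thesis by simp
  qed
  ultimately have "orth_proj S x = y"
    unfolding orth_proj_def by (intro the_equality conjI y)
  then show "orth_proj S x \<in> S" "x - orth_proj S x \<in> orth S"
    using y \<open>x - y \<in> orth S\<close> by simp_all
qed

section \<open>Operators with closed range\<close>

text \<open>The Baire category argument of the uniform boundedness principle.\<close>

lemma weakly_bounded_imp_bounded:
  fixes R :: "'a::{real_inner, complete_space} set"
  assumes R: "subspace R" "closed R" and "B \<subseteq> R"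
    and weak: "\<And>y. y \<in> R \<Longrightarrow> \<exists>c. \<forall>z\<in>B. \<bar>inner y z\<bar> \<le> c"
  shows "\<exists>C. \<forall>z\<in>B. norm z \<le> C"
proof -
  define F where "F n = R \<inter> (\<Inter>z\<in>B. {y. \<bar>inner y z\<bar> \<le> real n})" for n
  have clF: "closed (F n)" for n
    unfolding F_def by (intro closed_Int R closed_INT ballI closed_Collect_le continuous_intros)
  have "R \<subseteq> \<Union>(range F)"
  proof
    fix y assume y: "y \<in> R"
    obtain c where c: "\<And>z. z \<in> B \<Longrightarrow> \<bar>inner y z\<bar> \<le> c"
      using weak[OF y] by blast
    obtain n :: nat where "c \<le> real n"
      using real_arch_simple by blast
    then have "y \<in> F n"
      using c y by (force simp: F_def)
    then show "y \<in> \<Union>(range F)" by blast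
  qed
  then have UF: "\<Union>(range F) = R"
    by (auto simp: F_def)
  have cm: "completely_metrizable_space (top_of_set R)"
    using R(2) by (intro completely_metrizable_space_closedin[OF completely_metrizable_space_euclidean])
      (simp add: closed_closedin[symmetric])
  \<comment> \<open>Otherwise Baire's theorem in the complete space \<open>R\<close> would give
    \<open>R\<close>, the countable union of the closed sets \<open>F n\<close>, empty interior in
    itself.\<close>
  have "\<exists>n. top_of_set R interior_of (F n) \<noteq> {}"
  proof (rule ccontr)
    assume "\<not> ?thesis"
    then have "top_of_set R interior_of \<Union>(range F) = {}"
      using cm clF by (intro Baire_category_alt) (auto simp: closedin_closed_eq[OF R(2)] F_def)
    then have "R = {}"
      unfolding UF by (metis interior_of_topspace topspace_euclidean_subtopology)
    then show False
      using subspace_0[OF R(1)] by blast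
  qed
  then obtain n y0 where "y0 \<in> top_of_set R interior_of (F n)" by blast
  then obtain T where T: "openin (top_of_set R) T" "T \<subseteq> F n" "y0 \<in> T"
    by (auto simp: interior_of_def)
  then obtain e where e: "e > 0" "ball y0 e \<inter> R \<subseteq> F n"
    by (metis openin_contains_ball order_trans)
  have y0: "y0 \<in> F n" using T by blast
  have "norm z \<le> 4 * real n / e" if z: "z \<in> B" for z
  proof (cases "z = 0")
    case False
    \<comment> \<open>A step of half the radius in the direction of \<open>z\<close> stays in the
      ball. The bounds at its two endpoints give \<open>e / 2 * norm z \<le> 2 * n\<close>.\<close>
    define t where "t = e / 2 / norm z"
    have "y0 + t *\<^sub>R z \<in> R"
      using y0 z \<open>B \<subseteq> R\<close> by (intro subspace_add subspace_scale R) (auto simp: F_def)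
    moreover have "y0 + t *\<^sub>R z \<in> ball y0 e"
      using e False by (simp add: t_def dist_norm)
    ultimately have "\<bar>inner (y0 + t *\<^sub>R z) z\<bar> \<le> real n"
      using e z by (auto simp: F_def)
    moreover have "\<bar>inner y0 z\<bar> \<le> real n"
      using y0 z by (auto simp: F_def)
    moreover have "inner (y0 + t *\<^sub>R z) z = inner y0 z + e / 2 * norm z"
      using False by (simp add: t_def inner_add_left power2_eq_square flip: power2_norm_eq_inner)
    ultimately show ?thesis
      using e by (simp add: field_simps)
  qed (use e in simp)
  then show ?thesis by blast
qed

lemma subspace_closure:
  fixes S :: "'a::real_normed_vector set"
  assumes "subspace S"
  shows "subspace (closure S)"
  unfolding subspace_def
proof (intro conjI ballI allI)
  show "0 \<in> closure S"
    using subspace_0[OF assms] closure_subset by blast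
  show "x + y \<in> closure S" if "x \<in> closure S" "y \<in> closure S" for x y
    using that unfolding closure_sequential
    by (metis (mono_tags, lifting) assms subspace_add tendsto_add)
  show "c *\<^sub>R x \<in> closure S" if "x \<in> closure S" for x c
    using that unfolding closure_sequential
    by (metis (mono_tags, lifting) assms subspace_scale tendsto_scaleR tendsto_const)
qed

text \<open>A duality argument in two stages. The elements \<open>z\<close> of the range with
  \<open>norm (A z) \<le> 1\<close> are weakly bounded, because pairing \<open>T x\<close> with
  \<open>z\<close> is pairing \<open>x\<close> with \<open>A z\<close>. As the range is complete
  they are bounded, so \<open>A\<close> is bounded below on it. Vectors orthogonal to the kernel of
  \<open>T\<close> are limits of such \<open>A z\<close>, and testing against them gives the
  estimate for \<open>T\<close>.\<close>

lemma closed_range_bounded_below: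
  fixes T :: "'a::chilbert_space \<Rightarrow> 'b::chilbert_space"
  assumes T: "bounded_op UNIV T" and cl: "closed (range T)"
  shows "\<exists>c>0. \<forall>x\<in>orth {k. T k = 0}. c * norm x \<le> norm (T x)"
proof -
  define A where "A = hadjoint UNIV T"
  interpret T: bounded_linear T
    using T by (simp add: bounded_op_UNIV_iff)
  interpret A: bounded_linear A
    using bounded_op_hadjoint[OF T] by (simp add: bounded_op_UNIV_iff A_def)
  have adj: "inner (T x) z = inner x (A z)" for x z
    using cinner_hadjoint[OF T, of x z] by (simp flip: Re_cinner add: A_def)
  have R: "subspace (range T)"
    by (intro linear_subspace_image T.linear subspace_UNIV)
  have "\<exists>C. \<forall>z\<in>{z \<in> range T. norm (A z) \<le> 1}. norm z \<le> C"
  proof (rule weakly_bounded_imp_bounded[OF R cl])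
    fix y assume "y \<in> range T"
    then obtain x where x: "y = T x" by blast
    have "\<bar>inner y z\<bar> \<le> norm x" if "norm (A z) \<le> 1" for z
      using Cauchy_Schwarz_ineq2[of x "A z"] mult_left_mono[OF that norm_ge_zero[of x]]
      by (simp add: x adj)
    then show "\<exists>c. \<forall>z\<in>{z \<in> range T. norm (A z) \<le> 1}. \<bar>inner y z\<bar> \<le> c" by blast
  qed blast
  then obtain C0 where C0: "\<And>z. z \<in> range T \<Longrightarrow> norm (A z) \<le> 1 \<Longrightarrow> norm z \<le> C0"
    by blast
  \<comment> \<open>The maximum with 1 makes \<open>C\<close> positive, so that \<open>1 / C\<close>
    can serve as the lower bound.\<close>
  define C where "C = max C0 1"
  have "C > 0" by (simp add: C_def)
  have low: "norm z \<le> C * norm (A z)" if z: "z \<in> range T" for z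
  proof (cases "A z = 0")
    case True
    obtain x where "z = T x" using z by blast
    then have "inner z z = 0"
      using adj[of x z] True by simp
    then show ?thesis by (simp add: True)
  next
    case False
    have "norm ((1 / norm (A z)) *\<^sub>R z) \<le> C0"
      by (rule C0) (use False in \<open>auto simp: A.scaleR intro!: subspace_scale[OF R] z\<close>)
    then have "norm z \<le> C0 * norm (A z)"
      using False by (simp add: field_simps)
    also have "\<dots> \<le> C * norm (A z)"
      by (intro mult_right_mono) (auto simp: C_def)
    finally show ?thesis .
  qed
  have "norm x \<le> C * norm (T x)" if x: "x \<in> orth {k. T k = 0}" for x
  proof -
    define W where "W = closure (A ` range T)"
    have "subspace W"
      unfolding W_def by (intro subspace_closure linear_subspace_image A.linear R)
    moreover have "closed W" by (simp add: W_def)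
    ultimately obtain w where w: "w \<in> W" "\<And>z. z \<in> W \<Longrightarrow> inner (x - w) z = 0"
      using orthogonal_projection_exists by blast
    define u where "u = x - w"
    \<comment> \<open>Pairing \<open>u\<close> with this element of \<open>W\<close> gives the
      squared norm of \<open>T u\<close>, so \<open>u\<close> is in the kernel of \<open>T\<close>.
      Then \<open>x\<close> and \<open>w\<close> are both orthogonal to \<open>u\<close>, their
      difference, which therefore vanishes.\<close>
    have "A (T u) \<in> W"
      unfolding W_def by (rule subsetD[OF closure_subset]) blast
    then have "inner u (A (T u)) = 0"
      unfolding u_def by (rule w)
    then have "T u = 0"
      by (simp flip: adj)
    then have "inner x u = 0"
      using x by (auto simp: orth_def simp flip: Re_cinner)
    moreover have "inner u w = 0"
      unfolding u_def by (rule w(2)[OF w(1)])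
    ultimately have "inner u u = 0"
      by (simp add: u_def inner_diff_left inner_diff_right inner_commute)
    then have "x \<in> W"
      using w(1) by (simp add: u_def)
    then obtain y where y: "\<And>n. y n \<in> A ` range T" "y \<longlonglongrightarrow> x"
      unfolding W_def closure_sequential by auto
    have "\<forall>n. \<exists>z. z \<in> range T \<and> y n = A z"
      using y(1) by (auto simp: image_iff)
    then obtain z where "\<forall>n. z n \<in> range T \<and> y n = A (z n)"
      unfolding choice_iff ..
    then have z: "\<And>n. z n \<in> range T" "\<And>n. y n = A (z n)"
      by blast+
    have "inner x x \<le> norm (T x) * (C * norm x)"
    proof (rule LIMSEQ_le)
      show "(\<lambda>n. inner x (A (z n))) \<longlonglongrightarrow> inner x x"
        "(\<lambda>n. norm (T x) * (C * norm (A (z n)))) \<longlonglongrightarrow> norm (T x) * (C * norm x)"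
        using y(2) by (auto simp: z(2)[symmetric] intro!: tendsto_intros)
      have "inner x (A (z n)) \<le> norm (T x) * (C * norm (A (z n)))" for n
        unfolding adj[symmetric]
        using norm_cauchy_schwarz[of "T x" "z n"] mult_left_mono[OF low[OF z(1)[of n]] norm_ge_zero[of "T x"]]
        by linarith
      then show "\<exists>N. \<forall>n\<ge>N. inner x (A (z n)) \<le> norm (T x) * (C * norm (A (z n)))" by blast
    qed
    then have "norm x * norm x \<le> (C * norm (T x)) * norm x"
      by (simp add: power2_eq_square mult_ac flip: power2_norm_eq_inner)
    then show ?thesis
      using \<open>C > 0\<close> by (cases "x = 0") auto
  qed
  then show ?thesis
    using \<open>C > 0\<close> by (intro exI[of _ "1 / C"]) (auto simp: field_simps)
qed

section \<open>Column operators and local sections of their kernels\<close>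

lemma bounded_op_vec_lambda:
  fixes f :: "'i::finite \<Rightarrow> 'a::complex_inner \<Rightarrow> 'b::complex_inner"
  assumes "\<And>i. bounded_op UNIV (f i)"
  shows "bounded_op UNIV (\<lambda>x. \<chi> i. f i x)"
proof -
  have f: "bounded_linear (f i)" "f i (a *\<^sub>C x) = a *\<^sub>C f i x" for i a x
    using assms by (auto simp: bounded_op_UNIV_iff)
  obtain K where K: "\<And>i x. norm (f i x) \<le> norm x * K i"
    using bounded_linear.bounded[OF f(1)] by metis
  have "norm (\<chi> i. f i x) \<le> (\<Sum>i\<in>UNIV. K i) * norm x" for x
  proof -
    have "norm (\<chi> i. f i x) \<le> (\<Sum>i\<in>UNIV. norm (f i x))"
      by (simp add: norm_vec_def L2_set_le_sum)
    also have "\<dots> \<le> (\<Sum>i\<in>UNIV. K i) * norm x"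
      unfolding sum_distrib_right by (intro sum_mono) (metis K mult.commute)
    finally show ?thesis .
  qed
  then show ?thesis
    by (auto simp: bounded_op_def vec_eq_iff linear_simps[OF f(1)] f(2) scaleC_vec_def)
qed

lemma bounded_op_diff_scaleC:
  assumes "bounded_op UNIV T"
  shows "bounded_op UNIV (\<lambda>x. T x - a *\<^sub>C x)"
  using assms unfolding bounded_op_UNIV_iff
  by (auto intro!: bounded_linear_sub bounded_linear_scaleC
      simp: cvec.scale_right_diff_distrib scaleC_scaleC mult.commute)

lemma norm_vec_scaleC:
  fixes v :: "complex ^ 'n"
  shows "norm (\<chi> i. cnj (v $ i) *\<^sub>C h) = norm v * norm h"
proof -
  have "(norm (\<chi> i. cnj (v $ i) *\<^sub>C h))\<^sup>2 = (norm v * norm h)\<^sup>2"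
    by (simp add: norm_vec_def L2_set_def power_mult_distrib real_sqrt_pow2 sum_nonneg sum_distrib_right)
  then show ?thesis
    by (simp add: power2_eq_iff_nonneg)
qed

text \<open>
  The section \<open>s\<close> is normalized by \<open>\<langle>s(w), k\<rangle> = \<langle>k, k\<rangle>\<close> for a vector \<open>k\<close> spanning the kernel
  at \<open>w0\<close>. Near \<open>w0\<close> the operators \<open>A w\<close> are uniformly bounded below on the complement of
  \<open>k\<close>, and differences and derivatives of \<open>s\<close> take values there.
\<close>

lemma local_antiholomorphic_kernel_section:
  fixes L :: "'n::finite \<Rightarrow> 'h::chilbert_space \<Rightarrow> 'h" and \<Omega> :: "(complex ^ 'n) set"
  defines "A \<equiv> \<lambda>w h. \<chi> i. L i h - cnj (w $ i) *\<^sub>C h"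
  assumes L: "\<And>i. bounded_op UNIV (L i)" and "open \<Omega>" and w0: "w0 \<in> \<Omega>"
    and cl: "\<And>w. w \<in> \<Omega> \<Longrightarrow> closed (range (A w))"
    and ker: "\<And>w. w \<in> \<Omega> \<Longrightarrow> \<exists>k. k \<noteq> 0 \<and> {h. A w h = 0} = cvec.span {k}"
  shows "\<exists>U s. open U \<and> w0 \<in> U \<and> U \<subseteq> \<Omega> \<and> antiholomorphic_map U s \<and>
    (\<forall>w\<in>U. s w \<noteq> 0 \<and> A w (s w) = 0)"
proof -
  define J where "J v h = (\<chi> i. cnj (v $ i) *\<^sub>C h)" for v :: "complex ^ 'n" and h :: 'h
  have normJ: "norm (J v h) = norm v * norm h" for v h
    by (simp add: J_def norm_vec_scaleC)
  have J_add: "J (u + v) h = J u h + J v h"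
    and J_diff: "J v (h - h') = J v h - J v h'"
    and J_scale: "J (a *\<^sub>C v) h = cnj a *\<^sub>C J v h"
    for u v h h' a
    by (simp_all add: J_def vec_eq_iff cvec.scale_left_distrib cvec.scale_left_diff_distrib
        cvec.scale_right_diff_distrib scaleC_vec_def scaleC_complex_def scaleC_scaleC mult.commute)
  \<comment> \<open>\<open>A w\<close> depends affinely on the conjugate of \<open>w\<close>, and
    \<open>J\<close> is its exact increment, of norm \<open>norm v\<close> by
    \<open>normJ\<close>.\<close>
  have AJ: "A w h = A w' h - J (w - w') h" for w w' h
    by (simp add: A_def J_def vec_eq_iff cvec.scale_left_diff_distrib)
  have A_op: "bounded_op UNIV (A w)" for w
    unfolding A_def by (intro bounded_op_vec_lambda bounded_op_diff_scaleC L)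
  then have Abl: "bounded_linear (A w)" and A_scale: "A w (a *\<^sub>C x) = a *\<^sub>C A w x" for w x a
    by (auto simp: bounded_op_UNIV_iff)
  note A_lin = linear_simps[OF Abl]
  obtain k where k: "k \<noteq> 0" "{h. A w0 h = 0} = cvec.span {k}"
    using ker[OF w0] by (elim exE conjE)
  obtain c where c: "c > 0" "\<And>x. x \<in> orth {h. A w0 h = 0} \<Longrightarrow> c * norm x \<le> norm (A w0 x)"
    using closed_range_bounded_below[OF A_op cl[OF w0]] by blast
  have kk: "cinner k k \<noteq> 0"
    using k by simp
  \<comment> \<open>Within radius \<open>c / 2\<close> the perturbation \<open>J (w - w0)\<close>
    uses up at most half of the lower bound \<open>c\<close> at \<open>w0\<close>; this leaves
    \<open>c / 2\<close> in \<open>low\<close>.\<close>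
  define U where "U = \<Omega> \<inter> ball w0 (c / 2)"
  have U: "open U" "w0 \<in> U" "U \<subseteq> \<Omega>"
    using \<open>open \<Omega>\<close> w0 c by (auto simp: U_def)
  have low: "norm x \<le> 2 / c * norm (A w x)" if w: "w \<in> U" and x: "cinner x k = 0" for w x
  proof -
    have "x \<in> orth {h. A w0 h = 0}"
      using x by (auto simp: k(2) cvec.span_singleton orth_def cinner_scaleC_right)
    then have "c * norm x \<le> norm (A w0 x)"
      by (rule c(2))
    also have "A w0 x = A w x + J (w - w0) x"
      unfolding AJ[of w x w0] by simp
    finally have "c * norm x \<le> norm (A w x + J (w - w0) x)" .
    also have "\<dots> \<le> norm (A w x) + norm (w - w0) * norm x"
      unfolding normJ[symmetric] by (rule norm_triangle_ineq)
    also have "\<dots> \<le> norm (A w x) + c / 2 * norm x"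
      using w by (intro add_left_mono mult_right_mono) (auto simp: U_def dist_norm norm_minus_commute)
    finally show ?thesis
      using c(1) by (simp add: field_simps)
  qed
  have "\<exists>s. A w s = 0 \<and> cinner s k = cinner k k" if w: "w \<in> U" for w
  proof -
    obtain h where h: "h \<noteq> 0" "A w h = 0"
    proof -
      obtain h where "h \<noteq> 0" "{x. A w x = 0} = cvec.span {h}"
        using ker[OF subsetD[OF U(3) w]] by (elim exE conjE)
      moreover have "h \<in> cvec.span {h}"
        by (simp add: cvec.span_base)
      ultimately have "h \<in> {x. A w x = 0}"
        by simp
      then show ?thesis
        using that[of h] \<open>h \<noteq> 0\<close> by simp
    qed
    \<comment> \<open>A kernel vector orthogonal to \<open>k\<close> would contradict the lower
      bound, so the normalization against \<open>k\<close> is possible.\<close>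
    have "cinner h k \<noteq> 0"
    proof
      assume "cinner h k = 0"
      then have "norm h \<le> 2 / c * norm (A w h)"
        by (rule low[OF w])
      then show False
        using h by simp
    qed
    then show ?thesis
      by (intro exI[of _ "(cinner k k / cinner h k) *\<^sub>C h"])
        (simp add: A_scale h cinner_scaleC_left)
  qed
  then have "\<exists>s. \<forall>w\<in>U. A w (s w) = 0 \<and> cinner (s w) k = cinner k k"
    by (intro bchoice ballI)
  then obtain s where s: "\<And>w. w \<in> U \<Longrightarrow> A w (s w) = 0" "\<And>w. w \<in> U \<Longrightarrow> cinner (s w) k = cinner k k"
    by auto
  have s_ne: "s w \<noteq> 0" if "w \<in> U" for w
    using s(2)[OF that] kk by auto
  have diff: "A w (s w' - s w) = J (w' - w) (s w')" if "w \<in> U" "w' \<in> U" for w w'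
    using AJ[of w' "s w'" w] s(1) that by (simp add: A_lin)
  have s_dist: "norm (s w' - s w) \<le> 2 / c * (norm (w' - w) * norm (s w'))" if "w \<in> U" "w' \<in> U" for w w'
    using low[OF that(1), of "s w' - s w"] that s(2) by (simp add: diff normJ cinner_diff_left)
  \<comment> \<open>With radius \<open>c / 4\<close> the estimate \<open>s_dist\<close> bounds the
    difference by half of \<open>norm (s w')\<close>, which can be absorbed on the left.\<close>
  have s_bd: "norm (s w') \<le> 2 * norm (s w)" if w: "w \<in> U" "w' \<in> U" and n: "norm (w' - w) \<le> c / 4" for w w'
  proof -
    have "norm (s w' - s w) \<le> 2 / c * (c / 4 * norm (s w'))"
      using s_dist[OF w] n c(1) by (smt (verit) divide_nonneg_pos mult_left_mono mult_right_mono norm_ge_zero)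
    then have "norm (s w' - s w) \<le> norm (s w') / 2"
      using c(1) by simp
    then show ?thesis
      using norm_triangle_sub[of "s w'" "s w"] by linarith
  qed
  have "antiholomorphic_map U s"
    unfolding antiholomorphic_map_def
  proof
    fix w assume w: "w \<in> U"
    have near: "norm (s w' - s w) \<le> 4 / c * norm (s w) * norm (w' - w)"
      if "w' \<in> U" "norm (w' - w) \<le> c / 4" for w'
    proof -
      have "norm (s w' - s w) \<le> 2 / c * (norm (w' - w) * (2 * norm (s w)))"
        using s_dist[OF w that(1)] s_bd[OF w that] c(1)
        by (smt (verit) divide_nonneg_pos mult_left_mono norm_ge_zero)
      then show ?thesis by (simp add: mult_ac)
    qed
    \<comment> \<open>Formal differentiation of \<open>A w (s w) = 0\<close> in direction
      \<open>u\<close> gives this equation for the derivative of \<open>s\<close>; the normalization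
      of \<open>s\<close> makes the derivative orthogonal to \<open>k\<close>. Solvability is where
      closedness of the range at \<open>w\<close> enters.\<close>
    have "\<exists>n. cinner n k = 0 \<and> A w n = J u (s w)" for u
    proof -
      define wn where "wn m = w + inverse (Suc m) *\<^sub>R u" for m
      have wn: "wn \<longlonglongrightarrow> w"
        using tendsto_add[OF tendsto_const tendsto_scaleR[OF LIMSEQ_inverse_real_of_nat tendsto_const], of w u]
        by (simp add: wn_def[abs_def])
      then have n0: "(\<lambda>m. norm (wn m - w)) \<longlonglongrightarrow> 0"
        by (simp add: LIM_zero tendsto_norm_zero)
      then have ev: "\<forall>\<^sub>F m in sequentially. wn m \<in> U \<and> norm (wn m - w) \<le> c / 4"
        using eventually_conj[OF topological_tendstoD[OF wn U(1) w] order_tendstoD(2)[OF n0, of "c / 4"]] c(1)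
        by (auto elim!: eventually_mono)
      have "(\<lambda>m. 4 / c * norm (s w) * norm (wn m - w)) \<longlonglongrightarrow> 0"
        by (rule tendsto_mult_right_zero[OF n0])
      then have "(\<lambda>m. s (wn m) - s w) \<longlonglongrightarrow> 0"
        by (rule Lim_null_comparison[rotated]) (use ev near in \<open>auto elim: eventually_mono\<close>)
      then have "(\<lambda>m. norm (J u (s (wn m) - s w))) \<longlonglongrightarrow> 0"
        unfolding normJ by (intro tendsto_mult_right_zero tendsto_norm_zero)
      then have "(\<lambda>m. J u (s (wn m) - s w)) \<longlonglongrightarrow> 0"
        by (rule tendsto_norm_zero_cancel)
      then have "(\<lambda>m. J u (s (wn m) - s w) + J u (s w)) \<longlonglongrightarrow> 0 + J u (s w)"
        by (rule tendsto_add[OF _ tendsto_const])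
      then have "(\<lambda>m. J u (s (wn m))) \<longlonglongrightarrow> J u (s w)"
        by (simp add: J_diff)
      moreover have "\<forall>\<^sub>F m in sequentially. J u (s (wn m)) \<in> range (A w)"
        using ev
      proof (rule eventually_mono)
        fix m assume m: "wn m \<in> U \<and> norm (wn m - w) \<le> c / 4"
        \<comment> \<open>The rescaled difference quotient is an exact preimage of
          \<open>J u (s (wn m))\<close>, so the limit \<open>J u (s w)\<close> is a limit of
          elements of the range.\<close>
        have "A w (real (Suc m) *\<^sub>R (s (wn m) - s w)) = real (Suc m) *\<^sub>R J (wn m - w) (s (wn m))"
          using diff[OF w conjunct1[OF m]] by (simp only: A_lin(5))
        also have "\<dots> = J (real (Suc m) *\<^sub>R (wn m - w)) (s (wn m))"
          by (simp add: J_def vec_eq_iff scaleC_scaleC scaleR_conv_of_real[where 'a=complex]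
              del: of_nat_Suc flip: scaleC_of_real[where 'a='h])
        also have "real (Suc m) *\<^sub>R (wn m - w) = u"
          by (simp add: wn_def)
        finally show "J u (s (wn m)) \<in> range (A w)"
          by (rule range_eqI[OF sym])
      qed
      ultimately have "J u (s w) \<in> range (A w)"
        by (intro Lim_in_closed_set[OF cl[OF subsetD[OF U(3) w]] _ trivial_limit_sequentially])
      then obtain h where h: "J u (s w) = A w h" by (rule imageE)
      show ?thesis
      proof (intro exI conjI)
        \<comment> \<open>Subtracting a multiple of the kernel vector \<open>s w\<close> leaves the
          image unchanged and makes the solution orthogonal to \<open>k\<close>.\<close>
        let ?n = "h - (cinner h k / cinner k k) *\<^sub>C s w"
        show "cinner ?n k = 0"
          using kk by (simp add: cinner_diff_left cinner_scaleC_left s(2)[OF w])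
        show "A w ?n = J u (s w)"
          by (simp add: A_lin A_scale h s(1)[OF w])
      qed
    qed
    then have "\<exists>D. \<forall>u. cinner (D u) k = 0 \<and> A w (D u) = J u (s w)"
      by (intro choice allI)
    then obtain D where D: "\<And>u. cinner (D u) k = 0" "\<And>u. A w (D u) = J u (s w)"
      by auto
    \<comment> \<open>Uniqueness of the solution turns the choice function \<open>D\<close> into a
      conjugate-linear map, since \<open>J\<close> is conjugate-linear in its first
      argument.\<close>
    have uniq: "x = y" if "cinner x k = 0" "cinner y k = 0" "A w x = A w y" for x y
      using low[OF w, of "x - y"] that by (simp add: cinner_diff_left A_lin)
    have D_add: "D (u + v) = D u + D v" for u v
      by (rule uniq) (simp_all add: D cinner_add_left A_lin J_add)
    have D_scale: "D (a *\<^sub>C u) = cnj a *\<^sub>C D u" for a u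
      by (rule uniq) (simp_all add: D cinner_scaleC_left A_scale J_scale)
    have D_norm: "norm (D u) \<le> norm u * (2 / c * norm (s w))" for u
      using low[OF w D(1)[of u]] by (simp add: D normJ mult_ac)
    have D_bl: "bounded_linear D"
    proof (rule bounded_linear_intro[OF D_add _ D_norm])
      show "D (r *\<^sub>R u) = r *\<^sub>R D u" for r u
        using D_scale[of "of_real r" u] by (simp add: scaleC_of_real)
    qed
    obtain e where e: "e > 0" "ball w e \<subseteq> U"
      using U(1) w openE by blast
    have "(s has_derivative D) (at w)"
    proof (rule has_derivativeI_sandwich[OF _ D_bl])
      show "min e (c / 4) > 0" using e c by simp
      fix w' assume w': "w' \<noteq> w" "dist w' w < min e (c / 4)"
      then have "w' \<in> U"
        using e(2) by (auto simp: dist_commute)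
      have n: "norm (w' - w) \<le> c / 4"
        using w' by (simp add: dist_norm)
      \<comment> \<open>The remainder is orthogonal to \<open>k\<close>, and \<open>A w\<close> maps
        it to \<open>J (w' - w) (s w' - s w)\<close>. This is quadratic in \<open>w' - w\<close>
        because \<open>s\<close> is Lipschitz near \<open>w\<close>.\<close>
      have "norm (s w' - s w - D (w' - w)) \<le> 2 / c * norm (A w (s w' - s w - D (w' - w)))"
        using \<open>w' \<in> U\<close> w by (intro low) (simp_all add: cinner_diff_left s D)
      also have "A w (s w' - s w - D (w' - w)) = J (w' - w) (s w' - s w)"
        using diff[OF w \<open>w' \<in> U\<close>] by (simp add: A_lin(2) D J_diff)
      also have "2 / c * norm \<dots> \<le> 2 / c * (norm (w' - w) * (4 / c * norm (s w) * norm (w' - w)))"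
        unfolding normJ using c(1) near[OF \<open>w' \<in> U\<close> n] by (intro mult_left_mono) auto
      finally show "norm (s w' - s w - D (w' - w)) / norm (w' - w) \<le> 8 / c\<^sup>2 * norm (s w) * norm (w' - w)"
        using w'(1) by (simp add: field_simps power2_eq_square)
    next
      show "((\<lambda>w'. 8 / c\<^sup>2 * norm (s w) * norm (w' - w)) \<longlongrightarrow> 0) (at w)"
        by (intro tendsto_mult_right_zero tendsto_norm_zero LIM_zero tendsto_ident_at)
    qed
    then show "\<exists>D. (s has_derivative D) (at w) \<and> (\<forall>a v. D (a *\<^sub>C v) = cnj a *\<^sub>C D v)"
      using D_scale by blast
  qed
  then show ?thesis
    using U s(1) s_ne by (intro exI[of _ U] exI[of _ s]) simp
qed

section \<open>Anti-holomorphic maps and bundles\<close>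

lemma antiholomorphic_const: "antiholomorphic_map U (\<lambda>w. c)"
  unfolding antiholomorphic_map_def by (intro ballI exI[of _ "\<lambda>_. 0"]) simp

lemma antiholomorphic_diff:
  assumes "antiholomorphic_map U f" "antiholomorphic_map U g"
  shows "antiholomorphic_map U (\<lambda>w. f w - g w)"
  unfolding antiholomorphic_map_def
proof
  fix w assume w: "w \<in> U"
  obtain D D' where "(f has_derivative D) (at w)" "\<And>a v. D (a *\<^sub>C v) = cnj a *\<^sub>C D v"
    "(g has_derivative D') (at w)" "\<And>a v. D' (a *\<^sub>C v) = cnj a *\<^sub>C D' v"
    using assms w unfolding antiholomorphic_map_def by metis
  then show "\<exists>D. ((\<lambda>w. f w - g w) has_derivative D) (at w) \<and> (\<forall>a v. D (a *\<^sub>C v) = cnj a *\<^sub>C D v)"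
    by (intro exI[of _ "\<lambda>v. D v - D' v"])
      (auto intro: has_derivative_diff simp: cvec.scale_right_diff_distrib)
qed

lemma antiholomorphic_bilinear:
  assumes \<beta>: "bounded_bilinear \<beta>"
    and left: "\<And>a x y. \<beta> (a *\<^sub>C x) y = a *\<^sub>C \<beta> x y"
    and right: "\<And>a x y. \<beta> x (a *\<^sub>C y) = a *\<^sub>C \<beta> x y"
    and fg: "antiholomorphic_map U f" "antiholomorphic_map U g"
  shows "antiholomorphic_map U (\<lambda>w. \<beta> (f w) (g w))"
  unfolding antiholomorphic_map_def
proof
  fix w assume w: "w \<in> U"
  obtain D D' where "(f has_derivative D) (at w)" "\<And>a v. D (a *\<^sub>C v) = cnj a *\<^sub>C D v"
    "(g has_derivative D') (at w)" "\<And>a v. D' (a *\<^sub>C v) = cnj a *\<^sub>C D' v"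
    using fg w unfolding antiholomorphic_map_def by metis
  then show "\<exists>D. ((\<lambda>w. \<beta> (f w) (g w)) has_derivative D) (at w) \<and> (\<forall>a v. D (a *\<^sub>C v) = cnj a *\<^sub>C D v)"
    by (intro exI[of _ "\<lambda>v. \<beta> (f w) (D' v) + \<beta> (D v) (g w)"])
      (auto intro: bounded_bilinear.FDERIV[OF \<beta>] simp: left right cvec.scale_right_distrib)
qed

text \<open>Intended for the conjugate transpose, through which the holomorphic
  \<open>\<Theta>\<close> and \<open>\<Psi>\<close> yield anti-holomorphic families of
  matrices.\<close>

lemma antiholomorphic_compose_conjugate_linear:
  assumes C: "bounded_linear C" "\<And>a x. C (a *\<^sub>C x) = cnj a *\<^sub>C C x" and f: "holomorphic_map U f"
  shows "antiholomorphic_map U (\<lambda>w. C (f w))"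
  unfolding antiholomorphic_map_def
proof
  fix w assume w: "w \<in> U"
  obtain D where "(f has_derivative D) (at w)" "\<And>a v. D (a *\<^sub>C v) = a *\<^sub>C D v"
    using f w unfolding holomorphic_map_def by metis
  then show "\<exists>D. ((\<lambda>w. C (f w)) has_derivative D) (at w) \<and> (\<forall>a v. D (a *\<^sub>C v) = cnj a *\<^sub>C D v)"
    by (intro exI[of _ "\<lambda>v. C (D v)"]) (auto intro: bounded_linear.has_derivative[OF C(1)] simp: C(2))
qed

lemma antiholomorphic_map_isCont: "antiholomorphic_map U f \<Longrightarrow> w \<in> U \<Longrightarrow> isCont f w"
  unfolding antiholomorphic_map_def using has_derivative_continuous by blast

lemma antiholomorphic_map_subset: "antiholomorphic_map U f \<Longrightarrow> V \<subseteq> U \<Longrightarrow> antiholomorphic_map V f"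
  unfolding antiholomorphic_map_def by blast

lemma dim_antiholomorphic_bundle:
  assumes "antiholomorphic_bundle m \<Omega> E" "w \<in> \<Omega>"
  shows "cvec.dim (E w) = m"
proof -
  obtain U s where "w \<in> U" "\<forall>w\<in>U. inj_on (\<lambda>j. s j w) {..<m} \<and>
      cvec.independent ((\<lambda>j. s j w) ` {..<m}) \<and> cvec.span ((\<lambda>j. s j w) ` {..<m}) = E w"
    using assms unfolding antiholomorphic_bundle_def by metis
  then have s: "inj_on (\<lambda>j. s j w) {..<m}" "cvec.independent ((\<lambda>j. s j w) ` {..<m})"
    "cvec.span ((\<lambda>j. s j w) ` {..<m}) = E w"
    by auto
  show ?thesis
    using cvec.dim_span_eq_card_independent[OF s(2)] card_image[OF s(1)] s(3) by simp
qed

lemma antiholomorphic_bundle_cong: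
  assumes E: "antiholomorphic_bundle m \<Omega> E" and EF: "\<And>w. w \<in> \<Omega> \<Longrightarrow> E w = F w"
  shows "antiholomorphic_bundle m \<Omega> F"
  unfolding antiholomorphic_bundle_def
proof (intro conjI ballI)
  show "cvec.subspace (F w)" if "w \<in> \<Omega>" for w
    using E EF[OF that] that unfolding antiholomorphic_bundle_def by auto
  fix w0 assume "w0 \<in> \<Omega>"
  then obtain U s where Us: "open U" "w0 \<in> U" "U \<subseteq> \<Omega>" "\<forall>j<m. antiholomorphic_section U E (s j)"
    "\<forall>w\<in>U. inj_on (\<lambda>j. s j w) {..<m} \<and> cvec.independent ((\<lambda>j. s j w) ` {..<m}) \<and>
      cvec.span ((\<lambda>j. s j w) ` {..<m}) = E w"
    using E unfolding antiholomorphic_bundle_def by metis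
  have "E w = F w" if "w \<in> U" for w
    using that Us(3) EF by blast
  then show "\<exists>U s. open U \<and> w0 \<in> U \<and> U \<subseteq> \<Omega> \<and> (\<forall>j<m. antiholomorphic_section U F (s j)) \<and>
    (\<forall>w\<in>U. inj_on (\<lambda>j. s j w) {..<m} \<and> cvec.independent ((\<lambda>j. s j w) ` {..<m}) \<and>
      cvec.span ((\<lambda>j. s j w) ` {..<m}) = F w)"
    using Us by (intro exI[of _ U] exI[of _ s]) (simp add: antiholomorphic_section_def)
qed

text \<open>Subbundles of one trivial bundle with equal fibers have the same metric and the same
  sections, so the identity serves as the isomorphism.\<close>

lemma bundle_iso_cong:
  assumes "antiholomorphic_bundle m \<Omega> F" and EF: "\<And>w. w \<in> \<Omega> \<Longrightarrow> E w = F w"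
  shows "bundle_iso \<Omega> E F"
  unfolding bundle_iso_def
proof (intro conjI exI[of _ m] exI[of _ "\<lambda>w x. x"] ballI allI impI)
  show "antiholomorphic_bundle m \<Omega> E"
    using assms by (auto intro: antiholomorphic_bundle_cong[of m \<Omega> F])
  show "bij_betw (\<lambda>x. x) (E w) (F w)" if "w \<in> \<Omega>" for w
    using EF[OF that] by (simp add: bij_betw_def)
  show "antiholomorphic_section U E s \<longleftrightarrow> antiholomorphic_section U F s"
    if "open U \<and> U \<subseteq> \<Omega> \<and> (\<forall>w\<in>U. s w \<in> E w)" for U s
    using that EF by (auto simp: antiholomorphic_section_def)
qed (simp_all add: assms(1))

section \<open>Tensor products with a line bundle\<close>

lemma tensor_add_right: "k \<otimes> (x + y) = k \<otimes> x + k \<otimes> y"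
  and tensor_scaleC_right: "k \<otimes> (a *\<^sub>C x) = a *\<^sub>C (k \<otimes> x)"
  and tensor_add_left: "(k + l) \<otimes> x = k \<otimes> x + l \<otimes> x"
  and tensor_scaleC_left: "(a *\<^sub>C k) \<otimes> x = a *\<^sub>C (k \<otimes> x)"
  by (simp_all add: tensor_def vec_eq_iff scaleC_vec_def scaleC_complex_def scaleC_scaleC
      cvec.scale_left_distrib cvec.scale_right_distrib mult.commute)

lemma tensor_eq_0_iff: "k \<otimes> x = 0 \<longleftrightarrow> k = 0 \<or> x = 0"
  by (auto simp: tensor_def vec_eq_iff)

lemma linear_tensor: "Vector_Spaces.linear scaleC scaleC (\<lambda>x. k \<otimes> x)"
  by unfold_locales (simp_all add: tensor_add_right tensor_scaleC_right)

lemma tensor_diff_right: "k \<otimes> (x - y) = k \<otimes> x - k \<otimes> y"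
  by (simp add: tensor_def vec_eq_iff cvec.scale_left_diff_distrib)

lemma inj_tensor: "k \<noteq> 0 \<Longrightarrow> inj (\<lambda>x. k \<otimes> x)"
  by (rule injI) (metis tensor_diff_right eq_iff_diff_eq_0 tensor_eq_0_iff)

lemma norm_tensor: "norm (k \<otimes> x) = norm k * norm x"
proof -
  have "(norm (k \<otimes> x))\<^sup>2 = (norm k * norm x)\<^sup>2"
    by (simp add: tensor_def norm_vec_def L2_set_def power_mult_distrib real_sqrt_pow2 sum_nonneg
        sum_distrib_left mult.commute)
  then show ?thesis
    by (simp add: power2_eq_iff_nonneg)
qed

lemma bounded_bilinear_tensor: "bounded_bilinear (\<lambda>k x. k \<otimes> x)"
proof
  fix r :: real and k :: 'a and x :: "complex ^ 'b"
  show "(r *\<^sub>R k) \<otimes> x = r *\<^sub>R (k \<otimes> x)" "k \<otimes> (r *\<^sub>R x) = r *\<^sub>R (k \<otimes> x)"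
    using tensor_scaleC_left[of "of_real r" k x] tensor_scaleC_right[of k "of_real r" x]
    by (simp_all add: scaleC_of_real)
  show "\<exists>K. \<forall>(k::'a) (x::complex ^ 'b). norm (k \<otimes> x) \<le> norm k * norm x * K"
    by (rule exI[of _ 1]) (simp add: norm_tensor)
qed (simp_all add: tensor_add_left tensor_add_right)

text \<open>Scalars move across the tensor sign, so every elementary tensor can be written with the
  fixed vector \<open>k\<close>. The elementary tensors then already form a subspace, and taking the
  span adds nothing.\<close>

lemma tensor_bundle_line:
  assumes E: "E w = cvec.span {k}" and F: "cvec.subspace (F w)"
  shows "tensor_bundle E F w = (\<lambda>x. k \<otimes> x) ` F w"
proof -
  interpret Vector_Spaces.linear scaleC scaleC "\<lambda>x :: complex ^ 'q. k \<otimes> x"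
    by (rule linear_tensor)
  have "{l \<otimes> x |l x. l \<in> E w \<and> x \<in> F w} = (\<lambda>x. k \<otimes> x) ` F w"
  proof safe
    fix l x assume "l \<in> E w" and x: "x \<in> F w"
    then obtain a where "l = a *\<^sub>C k"
      unfolding E cvec.span_singleton by blast
    then have "l \<otimes> x = k \<otimes> (a *\<^sub>C x)"
      by (simp add: tensor_scaleC_left tensor_scaleC_right)
    then show "l \<otimes> x \<in> (\<lambda>x. k \<otimes> x) ` F w"
      using cvec.subspace_scale[OF F x] by blast
  next
    fix x assume "x \<in> F w"
    then show "\<exists>l y. k \<otimes> x = l \<otimes> y \<and> l \<in> E w \<and> y \<in> F w"
      unfolding E using cvec.span_base[of k "{k}"] by blast
  qed
  then show ?thesis
    unfolding tensor_bundle_def using subspace_image[OF F] by (simp add: cvec.span_eq_iff)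
qed

text \<open>A nonvanishing section \<open>k\<close> of the line bundle tensored with a frame of
  \<open>F\<close> is a frame: tensoring with \<open>k w\<close> is an injective linear map, hence
  preserves independence and carries spans to spans.\<close>

lemma antiholomorphic_bundle_tensor:
  assumes E: "antiholomorphic_bundle 1 \<Omega> E" and F: "antiholomorphic_bundle m \<Omega> F"
  shows "antiholomorphic_bundle m \<Omega> (tensor_bundle E F)"
  unfolding antiholomorphic_bundle_def
proof (intro conjI ballI)
  show "cvec.subspace (tensor_bundle E F w)" for w
    by (simp add: tensor_bundle_def cvec.subspace_span)
  fix w0 assume "w0 \<in> \<Omega>"
  then obtain U s where U: "open U" "w0 \<in> U" "U \<subseteq> \<Omega>" "\<forall>j<1. antiholomorphic_section U E (s j)"
      "\<forall>w\<in>U. inj_on (\<lambda>j. s j w) {..<1::nat} \<and> cvec.independent ((\<lambda>j. s j w) ` {..<1}) \<and>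
        cvec.span ((\<lambda>j. s j w) ` {..<1}) = E w"
    using E unfolding antiholomorphic_bundle_def by metis
  from \<open>w0 \<in> \<Omega>\<close> obtain V t where V: "open V" "w0 \<in> V" "V \<subseteq> \<Omega>"
      "\<forall>j<m. antiholomorphic_section V F (t j)"
      "\<forall>w\<in>V. inj_on (\<lambda>j. t j w) {..<m} \<and> cvec.independent ((\<lambda>j. t j w) ` {..<m}) \<and>
        cvec.span ((\<lambda>j. t j w) ` {..<m}) = F w"
    using F unfolding antiholomorphic_bundle_def by metis
  define k where "k = s 0"
  have k: "antiholomorphic_map U k" "k w \<noteq> 0" "E w = cvec.span {k w}" if "w \<in> U" for w
  proof -
    have "{..<1} = {0::nat}" by auto
    then show "antiholomorphic_map U k" "k w \<noteq> 0" "E w = cvec.span {k w}"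
      using U(4,5) that by (auto simp: k_def antiholomorphic_section_def)
  qed
  have sub: "cvec.subspace (F w)" if "w \<in> \<Omega>" for w
    using F that unfolding antiholomorphic_bundle_def by blast
  have tb: "tensor_bundle E F w = (\<lambda>x. k w \<otimes> x) ` F w" if "w \<in> U \<inter> V" for w
    using that V(3) by (intro tensor_bundle_line k(3) sub) auto
  show "\<exists>U s. open U \<and> w0 \<in> U \<and> U \<subseteq> \<Omega> \<and>
      (\<forall>j<m. antiholomorphic_section U (tensor_bundle E F) (s j)) \<and>
      (\<forall>w\<in>U. inj_on (\<lambda>j. s j w) {..<m} \<and> cvec.independent ((\<lambda>j. s j w) ` {..<m}) \<and>
        cvec.span ((\<lambda>j. s j w) ` {..<m}) = tensor_bundle E F w)"
  proof (intro exI[of _ "U \<inter> V"] exI[of _ "\<lambda>j w. k w \<otimes> t j w"] conjI allI impI ballI)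
    fix j assume j: "j < m"
    have t: "antiholomorphic_map V (t j)" "\<And>w. w \<in> V \<Longrightarrow> t j w \<in> F w"
      using V(4) j by (auto simp: antiholomorphic_section_def)
    have "antiholomorphic_map (U \<inter> V) (\<lambda>w. k w \<otimes> t j w)"
      by (rule antiholomorphic_bilinear[OF bounded_bilinear_tensor tensor_scaleC_left tensor_scaleC_right])
        (use k(1)[OF U(2)] t(1) in \<open>auto elim: antiholomorphic_map_subset\<close>)
    then show "antiholomorphic_section (U \<inter> V) (tensor_bundle E F) (\<lambda>w. k w \<otimes> t j w)"
      using t(2) by (auto simp: antiholomorphic_section_def tb)
  next
    fix w assume w: "w \<in> U \<inter> V"
    interpret Vector_Spaces.linear scaleC scaleC "\<lambda>x :: complex ^ 'c. k w \<otimes> x"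
      by (rule linear_tensor)
    have inj: "inj (\<lambda>x :: complex ^ 'c. k w \<otimes> x)"
      using k(2) w by (intro inj_tensor) auto
    have t: "inj_on (\<lambda>j. t j w) {..<m}" "cvec.independent ((\<lambda>j. t j w) ` {..<m})"
      "cvec.span ((\<lambda>j. t j w) ` {..<m}) = F w"
      using V(5) w by auto
    have im: "(\<lambda>j. k w \<otimes> t j w) ` {..<m} = (\<lambda>x. k w \<otimes> x) ` (\<lambda>j. t j w) ` {..<m}"
      by (simp add: image_image)
    show "inj_on (\<lambda>j. k w \<otimes> t j w) {..<m}"
      using t(1) inj by (auto simp: inj_on_def)
    show "cvec.independent ((\<lambda>j. k w \<otimes> t j w) ` {..<m})"
      unfolding im using inj by (intro independent_injective_image t(2)) (auto simp: inj_on_def)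
    show "cvec.span ((\<lambda>j. k w \<otimes> t j w) ` {..<m}) = tensor_bundle E F w"
      unfolding im span_image t(3) tb[OF w] ..
  qed (use U V in auto)
qed

section \<open>Matrices\<close>

definition cadj :: "complex ^ 'p ^ 'q \<Rightarrow> complex ^ 'q ^ 'p"
  where "cadj A = (\<chi> i j. cnj (A $ j $ i))"

lemma cinner_matrix_vector_mult: "cinner (A *v x) y = cinner x (cadj A *v y)"
proof -
  have "cinner (A *v x) y = (\<Sum>i\<in>UNIV. \<Sum>j\<in>UNIV. A $ i $ j * x $ j * cnj (y $ i))"
    by (simp add: cinner_vec_def cinner_complex_def matrix_vector_mult_def sum_distrib_right)
  also have "\<dots> = (\<Sum>j\<in>UNIV. \<Sum>i\<in>UNIV. A $ i $ j * x $ j * cnj (y $ i))"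
    by (rule sum.swap)
  also have "\<dots> = cinner x (cadj A *v y)"
    by (simp add: cinner_vec_def cinner_complex_def matrix_vector_mult_def cadj_def
        sum_distrib_left mult_ac)
  finally show ?thesis .
qed

lemma hadjoint_matrix_vector_mult: "hadjoint UNIV ((*v) A) y = cadj A *v y"
  by (rule hadjoint_eqI) (simp_all add: cinner_matrix_vector_mult)

lemma cadj_matrix_mult: "cadj (A ** B) = cadj B ** cadj A"
  by (simp add: cadj_def matrix_matrix_mult_def vec_eq_iff mult.commute)

lemma cadj_mat_1: "cadj (mat 1) = mat 1"
  by (simp add: cadj_def mat_def vec_eq_iff)

lemma bounded_linear_cadj: "bounded_linear (cadj :: complex ^ 'p ^ 'q \<Rightarrow> complex ^ 'q ^ 'p)"
  unfolding linear_conv_bounded_linear[symmetric]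
  by (rule linearI) (simp_all add: cadj_def vec_eq_iff)

lemma cadj_scaleC: "cadj (a *\<^sub>C A) = cnj a *\<^sub>C cadj A"
  by (simp add: cadj_def vec_eq_iff scaleC_vec_def scaleC_complex_def)

lemma bounded_bilinear_matrix_vector_mult:
  "bounded_bilinear ((*v) :: complex ^ 'p ^ 'q \<Rightarrow> complex ^ 'p \<Rightarrow> complex ^ 'q)"
  unfolding bilinear_conv_bounded_bilinear[symmetric] bilinear_def
  by (auto intro!: linearI simp: matrix_vector_mult_def vec_eq_iff algebra_simps sum.distrib
      scaleR_sum_right)

text \<open>Identifies the \<open>cvec\<close> notions on \<open>complex ^ 'q\<close> with the
  \<open>vec\<close> notions, so that finite-dimensional linear algebra can be used for the fibers
  of \<open>V_bundle\<close>.\<close>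

lemma scaleC_eq_vector_scalar_mult: "(*\<^sub>C) = ((*s) :: complex \<Rightarrow> complex ^ 'q \<Rightarrow> complex ^ 'q)"
  by (simp add: fun_eq_iff vec_eq_iff scaleC_vec_def scaleC_complex_def)

lemma matrix_vector_mult_scaleC:
  "A *v (a *\<^sub>C x) = a *\<^sub>C (A *v x)" "(a *\<^sub>C A) *v x = a *\<^sub>C (A *v x)"
  for A :: "complex ^ 'p ^ 'q"
  by (simp_all add: matrix_vector_mult_def vec_eq_iff scaleC_vec_def scaleC_complex_def
      sum_distrib_left mult_ac)

section \<open>Rank and local frames of the kernel bundle \<open>V_bundle\<close>\<close>

lemma V_bundle_eq: "V_bundle \<Theta> w = {x. cadj (\<Theta> w) *v x = 0}"
proof -
  have "(\<forall>y. cinner x (\<Theta> w *v y) = 0) \<longleftrightarrow> (\<forall>y. cinner y (cadj (\<Theta> w) *v x) = 0)" for x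
    by (metis cinner_commute cinner_matrix_vector_mult complex_cnj_zero)
  also have "(\<forall>y. cinner y (cadj (\<Theta> w) *v x) = 0) \<longleftrightarrow> cadj (\<Theta> w) *v x = 0" for x
    by (metis cinner_eq_zero_iff cinner_zero_right)
  finally show ?thesis
    by (auto simp: V_bundle_def orth_def)
qed

text \<open>The right inverse \<open>F\<close> is injective, and its range is a complement of the
  kernel of \<open>G\<close>: the component of \<open>x\<close> in that range is
  \<open>F *v (G *v x)\<close>.\<close>

lemma dim_kernel_right_invertible_matrix:
  fixes G :: "complex ^ 'q ^ 'p" and F :: "complex ^ 'p ^ 'q"
  assumes "G ** F = mat 1"
  shows "vec.dim {x. G *v x = 0} = CARD('q) - CARD('p)"
proof -
  have GF: "G *v (F *v y) = y" for y
    by (simp add: matrix_vector_mul_assoc assms)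
  let ?V = "{x. G *v x = 0}" and ?W = "range ((*v) F)"
  have "vec.subspace ?V"
    by (auto simp: vec.subspace_def matrix_vector_right_distrib vec.scale)
  moreover have "vec.subspace ?W"
    by (intro vec.subspace_image vec.subspace_UNIV)
  ultimately have "vec.dim {x + y |x y. x \<in> ?V \<and> y \<in> ?W} + vec.dim (?V \<inter> ?W) = vec.dim ?V + vec.dim ?W"
    by (rule vec.dim_sums_Int)
  moreover have "{x + y |x y. x \<in> ?V \<and> y \<in> ?W} = UNIV"
  proof -
    have "x \<in> {x + y |x y. x \<in> ?V \<and> y \<in> ?W}" for x
    proof -
      have "x = (x - F *v (G *v x)) + F *v (G *v x)" "G *v (x - F *v (G *v x)) = 0"
        by (simp_all add: matrix_vector_mult_diff_distrib GF)
      then show ?thesis by blast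
    qed
    then show ?thesis by blast
  qed
  moreover have "?V \<inter> ?W = {0}"
    by (auto simp: GF intro: range_eqI[of _ _ 0])
  moreover have "vec.dim ?W = CARD('p)"
  proof -
    have "inj ((*v) F)"
      using GF by (metis injI)
    then have "vec.dim ?W = vec.dim (UNIV :: (complex ^ 'p) set)"
      by (intro vec.dim_image_eq matrix_vector_mul_linear_gen) (auto simp: inj_on_def)
    then show ?thesis
      by (simp add: card_cart_basis vec.dimension_def)
  qed
  ultimately show ?thesis
    by (simp add: card_cart_basis vec.dimension_def)
qed

text \<open>
  The idempotents \<open>Q w\<close> onto the fibers vary anti-holomorphically, so they carry a basis of
  the fiber at \<open>w0\<close> to a frame near \<open>w0\<close>.
\<close>

lemma antiholomorphic_bundle_V_bundle:
  fixes \<Theta> :: "complex ^ 'n::finite \<Rightarrow> complex ^ 'p ^ 'q" and \<Psi> :: "complex ^ 'n \<Rightarrow> complex ^ 'q ^ 'p"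
  assumes "open \<Omega>" and hol: "holomorphic_map \<Omega> \<Theta>" "holomorphic_map \<Omega> \<Psi>"
    and inv: "\<And>w. w \<in> \<Omega> \<Longrightarrow> \<Psi> w ** \<Theta> w = mat 1"
  shows "antiholomorphic_bundle (CARD('q) - CARD('p)) \<Omega> (V_bundle \<Theta>)"
proof -
  let ?m = "CARD('q) - CARD('p)"
  define G where "G w = cadj (\<Theta> w)" for w
  define F where "F w = cadj (\<Psi> w)" for w
  define Q where "Q w x = x - F w *v (G w *v x)" for w x
  have anti: "antiholomorphic_map \<Omega> G" "antiholomorphic_map \<Omega> F"
    unfolding G_def F_def
    by (intro antiholomorphic_compose_conjugate_linear bounded_linear_cadj cadj_scaleC hol)+
  have GF: "G w ** F w = mat 1" if "w \<in> \<Omega>" for w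
    using inv[OF that] by (simp add: G_def F_def cadj_mat_1 flip: cadj_matrix_mult)
  have V: "V_bundle \<Theta> w = {x. G w *v x = 0}" for w
    by (simp add: V_bundle_eq G_def)
  have GQ: "G w *v Q w x = 0" if "w \<in> \<Omega>" for w x
    by (simp only: Q_def matrix_vector_mult_diff_distrib matrix_vector_mul_assoc[of "G w"] GF[OF that])
      simp
  have subV: "vec.subspace (V_bundle \<Theta> w)" for w
    by (auto simp: V vec.subspace_def matrix_vector_right_distrib vec.scale)
  have dimV: "vec.dim (V_bundle \<Theta> w) = ?m" if "w \<in> \<Omega>" for w
    unfolding V by (rule dim_kernel_right_invertible_matrix[OF GF[OF that]])
  obtain K where K: "K > 0" "\<And>(A :: complex ^ 'p ^ 'q) x. norm (A *v x) \<le> norm A * norm x * K"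
    using bounded_bilinear.pos_bounded[OF bounded_bilinear_matrix_vector_mult] by blast
  obtain K' where K': "K' > 0" "\<And>(A :: complex ^ 'q ^ 'p) x. norm (A *v x) \<le> norm A * norm x * K'"
    using bounded_bilinear.pos_bounded[OF bounded_bilinear_matrix_vector_mult] by blast
  have "\<exists>U s. open U \<and> w0 \<in> U \<and> U \<subseteq> \<Omega> \<and>
      (\<forall>j<?m. antiholomorphic_section U (V_bundle \<Theta>) (s j)) \<and>
      (\<forall>w\<in>U. inj_on (\<lambda>j. s j w) {..<?m} \<and> vec.independent ((\<lambda>j. s j w) ` {..<?m}) \<and>
        vec.span ((\<lambda>j. s j w) ` {..<?m}) = V_bundle \<Theta> w)" if w0: "w0 \<in> \<Omega>" for w0
  proof -
    obtain B where B: "B \<subseteq> V_bundle \<Theta> w0" "vec.independent B" "V_bundle \<Theta> w0 \<subseteq> vec.span B" "card B = ?m"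
      using vec.basis_exists[of "V_bundle \<Theta> w0"] dimV[OF w0] by metis
    have "finite B"
      using B(2) by (rule vec.finiteI_independent)
    then obtain e where e: "bij_betw e {..<?m} B"
      using ex_bij_betw_nat_finite[of B] B(4) by (auto simp: atLeast0LessThan)
    have spanB: "vec.span B = V_bundle \<Theta> w0"
      using B(1,3) subV vec.span_subspace by blast
    have "isCont G w0" "isCont F w0"
      using anti w0 by (auto intro: antiholomorphic_map_isCont)
    \<comment> \<open>This factor vanishes at \<open>w0\<close>. Times \<open>norm x\<close>, it
      bounds \<open>F w *v ((G w - G w0) *v x)\<close>; \<open>K\<close> and \<open>K'\<close> come
      from the two matrix products.\<close>
    then have "isCont (\<lambda>w. norm (F w) * (norm (G w - G w0) * K') * K) w0"
      by (intro continuous_intros)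
    then have "((\<lambda>w. norm (F w) * (norm (G w - G w0) * K') * K) \<longlongrightarrow> 0) (at w0)"
      by (simp add: isCont_def)
    then have "\<forall>\<^sub>F w in at w0. norm (F w) * (norm (G w - G w0) * K') * K < 1"
      by (rule order_tendstoD) simp
    then have "\<forall>\<^sub>F w in nhds w0. norm (F w) * (norm (G w - G w0) * K') * K < 1"
      by (auto simp: eventually_at_filter elim!: eventually_mono)
    then obtain U0 where U0: "open U0" "w0 \<in> U0" "\<And>w. w \<in> U0 \<Longrightarrow> norm (F w) * (norm (G w - G w0) * K') * K < 1"
      unfolding eventually_nhds by blast
    define U where "U = U0 \<inter> \<Omega>"
    have U: "open U" "w0 \<in> U" "U \<subseteq> \<Omega>"
      using U0 \<open>open \<Omega>\<close> w0 by (auto simp: U_def)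
    have lin: "Vector_Spaces.linear (*s) (*s) (Q w)" for w
      by unfold_locales (simp_all add: Q_def vec.add vec.scale vec.scale_right_diff_distrib)
    have ker: "x = 0" if w: "w \<in> U" and x: "x \<in> V_bundle \<Theta> w0" "Q w x = 0" for w x
    \<comment> \<open>Since \<open>G w0 *v x = 0\<close>, a vector of the fiber at \<open>w0\<close>
      killed by \<open>Q w\<close> is a fixed point of a map whose norm is below 1 near
      \<open>w0\<close>.\<close>
    proof (rule ccontr)
      assume "x \<noteq> 0"
      have "x = F w *v ((G w - G w0) *v x)"
        using x by (simp add: Q_def V matrix_vector_mult_diff_rdistrib)
      then have "norm x \<le> norm (F w) * norm ((G w - G w0) *v x) * K"
        using K(2) by metis
      also have "\<dots> \<le> norm (F w) * (norm (G w - G w0) * norm x * K') * K"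
        using K by (intro mult_right_mono mult_left_mono K') auto
      also have "\<dots> = (norm (F w) * (norm (G w - G w0) * K') * K) * norm x"
        by (simp add: mult_ac)
      also have "\<dots> < 1 * norm x"
        using U0(3)[of w] w \<open>x \<noteq> 0\<close> by (intro mult_strict_right_mono) (auto simp: U_def)
      finally show False by simp
    qed
    show ?thesis
    proof (intro exI[of _ U] exI[of _ "\<lambda>j w. Q w (e j)"] conjI allI impI ballI U)
      fix j
      have "antiholomorphic_map U (\<lambda>w. Q w (e j))"
        unfolding Q_def using anti U(3)
        by (intro antiholomorphic_diff antiholomorphic_const
            antiholomorphic_bilinear[OF bounded_bilinear_matrix_vector_mult])
          (auto simp: matrix_vector_mult_scaleC elim: antiholomorphic_map_subset)
      then show "antiholomorphic_section U (V_bundle \<Theta>) (\<lambda>w. Q w (e j))"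
        using GQ U(3) by (auto simp: antiholomorphic_section_def V)
    next
      fix w assume w: "w \<in> U"
      interpret Q: Vector_Spaces.linear "(*s)" "(*s)" "Q w"
        by (rule lin)
      have inj: "inj_on (Q w) (vec.span B)"
        unfolding spanB
      proof (rule inj_onI)
        fix x y assume xy: "x \<in> V_bundle \<Theta> w0" "y \<in> V_bundle \<Theta> w0" "Q w x = Q w y"
        have "x - y \<in> V_bundle \<Theta> w0"
          by (rule vec.subspace_diff[OF subV xy(1,2)])
        moreover have "Q w (x - y) = 0"
          unfolding Q.diff xy(3) by simp
        ultimately have "x - y = 0"
          by (rule ker[OF w])
        then show "x = y" by simp
      qed
      have im: "(\<lambda>j. Q w (e j)) ` {..<?m} = Q w ` B"
        using e by (simp add: bij_betw_def flip: image_image)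
      have injB: "inj_on (Q w) B"
        using inj vec.span_superset by (rule inj_on_subset)
      show "inj_on (\<lambda>j. Q w (e j)) {..<?m}"
        using comp_inj_on[of e "{..<?m}" "Q w"] e injB by (simp add: bij_betw_def comp_def)
      show ind: "vec.independent ((\<lambda>j. Q w (e j)) ` {..<?m})"
        unfolding im by (rule Q.independent_injective_image[OF B(2) inj])
      have "Q w ` B \<subseteq> V_bundle \<Theta> w"
        using GQ w U(3) by (auto simp: V)
      moreover have "card (Q w ` B) = vec.dim (V_bundle \<Theta> w)"
        using card_image[OF injB] B(4) dimV w U(3) by auto
      \<comment> \<open>An independent subset of the fiber with as many elements as its dimension
        spans it.\<close>
      ultimately have "V_bundle \<Theta> w \<subseteq> vec.span (Q w ` B)"
        using vec.card_eq_dim[of "Q w ` B"] \<open>finite B\<close> ind im by auto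
      then show "vec.span ((\<lambda>j. Q w (e j)) ` {..<?m}) = V_bundle \<Theta> w"
        unfolding im using \<open>Q w ` B \<subseteq> _\<close> subV by (intro vec.span_subspace)
    qed
  qed
  then show ?thesis
    unfolding antiholomorphic_bundle_def scaleC_eq_vector_scalar_mult using subV by blast
qed

section \<open>Compressions\<close>

lemma bounded_op_subset: "bounded_op UNIV T \<Longrightarrow> bounded_op S T"
  unfolding bounded_op_def by blast

lemma bounded_op_ampliation:
  fixes T :: "'h::complex_inner \<Rightarrow> 'h"
  assumes "bounded_op UNIV T"
  shows "bounded_op UNIV (ampliation T :: 'h ^ 'q \<Rightarrow> 'h ^ 'q)"
  unfolding ampliation_def
proof (rule bounded_op_vec_lambda)
  show "bounded_op UNIV (\<lambda>x :: 'h ^ 'q. T (x $ j))" for j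
    using assms unfolding bounded_op_UNIV_iff
    by (auto intro: bounded_linear_compose[OF _ bounded_linear_vec_nth] simp: scaleC_vec_def)
qed

lemma cinner_ampliation:
  fixes T :: "'h::chilbert_space \<Rightarrow> 'h"
  assumes "bounded_op UNIV T"
  shows "cinner (ampliation T x) y = cinner x (ampliation (hadjoint UNIV T) y)"
  by (simp add: cinner_vec_def ampliation_def cinner_hadjoint[OF assms])

lemma hadjoint_diff_scaleC:
  fixes T :: "'h::chilbert_space \<Rightarrow> 'h"
  assumes "bounded_op UNIV T"
  shows "hadjoint UNIV (\<lambda>x. T x - a *\<^sub>C x) h = hadjoint UNIV T h - cnj a *\<^sub>C h"
  by (rule hadjoint_eqI)
    (simp_all add: cinner_diff_left cinner_diff_right cinner_scaleC_left cinner_scaleC_right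
      cinner_hadjoint[OF assms])

lemma orth_proj_eqI:
  fixes S :: "'a::chilbert_space set"
  assumes S: "cvec.subspace S" "closed S" and y: "y \<in> S" "x - y \<in> orth S"
  shows "orth_proj S x = y"
proof -
  have "(x - y) - (x - orth_proj S x) \<in> orth S"
    by (rule cvec.subspace_diff[OF csubspace_orth y(2) orth_proj_properties(2)[OF S]])
  moreover have "orth_proj S x - y \<in> S"
    by (rule cvec.subspace_diff[OF S(1) orth_proj_properties(1)[OF S] y(1)])
  ultimately have "cinner (orth_proj S x - y) (orth_proj S x - y) = 0"
    by (simp add: orth_def)
  then show ?thesis by simp
qed

lemma cinner_orth_proj:
  fixes S :: "'a::chilbert_space set"
  assumes S: "cvec.subspace S" "closed S" and "h \<in> S"
  shows "cinner (orth_proj S x) h = cinner x h"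
  using orth_proj_properties(2)[OF S, of x] \<open>h \<in> S\<close> by (simp add: orth_def cinner_diff_left)

lemma bounded_op_orth_proj:
  fixes S :: "'a::chilbert_space set"
  assumes S: "cvec.subspace S" "closed S"
  shows "bounded_op UNIV (orth_proj S)"
proof -
  note P = orth_proj_properties[OF S]
  have "orth_proj S (x + y) = orth_proj S x + orth_proj S y" for x y
  proof (rule orth_proj_eqI[OF S])
    show "orth_proj S x + orth_proj S y \<in> S"
      by (intro cvec.subspace_add S P)
    have "(x - orth_proj S x) + (y - orth_proj S y) \<in> orth S"
      by (intro cvec.subspace_add csubspace_orth P)
    then show "x + y - (orth_proj S x + orth_proj S y) \<in> orth S"
      by (simp add: algebra_simps)
  qed
  moreover have "orth_proj S (a *\<^sub>C x) = a *\<^sub>C orth_proj S x" for a x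
    using cvec.subspace_scale[OF csubspace_orth P(2)[of x], of a]
    by (intro orth_proj_eqI[OF S] cvec.subspace_scale S P) (simp add: cvec.scale_right_diff_distrib)
  moreover have "norm (orth_proj S x) \<le> 1 * norm x" for x
  proof (cases "orth_proj S x = 0")
    case False
    have "cinner (orth_proj S x) (orth_proj S x) = cinner x (orth_proj S x)"
      by (rule cinner_orth_proj[OF S P(1)])
    then have "(norm (orth_proj S x))\<^sup>2 = inner x (orth_proj S x)"
      by (metis Re_cinner power2_norm_eq_inner)
    also have "\<dots> \<le> norm x * norm (orth_proj S x)"
      by (rule norm_cauchy_schwarz)
    finally show ?thesis
      using False by (simp add: power2_eq_square)
  qed simp
  ultimately show ?thesis
    unfolding bounded_op_def by blast
qed

lemma csubspace_closure:
  fixes S :: "'a::complex_inner set"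
  assumes "cvec.subspace S"
  shows "cvec.subspace (closure S)"
proof -
  have "a *\<^sub>C x \<in> closure S" if "x \<in> closure S" for a x
  proof -
    have "(\<lambda>x. a *\<^sub>C x) ` closure S \<subseteq> closure ((\<lambda>x. a *\<^sub>C x) ` S)"
      by (intro closure_bounded_linear_image_subset bounded_linear_scaleC)
    also have "\<dots> \<subseteq> closure S"
      by (intro closure_mono) (auto intro: cvec.subspace_scale[OF assms])
    finally show ?thesis using that by blast
  qed
  then show ?thesis
    using subspace_closure[OF subspace_if_csubspace[OF assms]]
    by (simp add: cvec.subspace_def subspace_def)
qed

lemma separable_vec:
  assumes "separable_set (UNIV :: 'a::metric_space set)"
  shows "separable_set (UNIV :: ('a ^ 'q) set)"
proof -
  obtain D :: "'a set" where D: "countable D" "closure D = UNIV"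
    using assms by (auto simp: separable_set_def)
  define X where "X = (vec_lambda ` PiE UNIV (\<lambda>_. D) :: ('a ^ 'q) set)"
  have "x \<in> closure X" for x
  proof (unfold closure_approachable, intro allI impI)
    fix e :: real assume "e > 0"
    \<comment> \<open>The factor 2 gives the final strict inequality, since the sum is only bounded
      weakly, by \<open>e / 2\<close>.\<close>
    define \<delta> where "\<delta> = e / (2 * real CARD('q))"
    have \<delta>: "\<delta> > 0" using \<open>e > 0\<close> by (simp add: \<delta>_def)
    have "\<forall>j. \<exists>d\<in>D. dist d (x $ j) < \<delta>"
      using D(2) \<delta> by (metis UNIV_I closure_approachable)
    then obtain d where d: "\<And>j. d j \<in> D" "\<And>j. dist (d j) (x $ j) < \<delta>"
      by metis
    have "dist (vec_lambda d) x \<le> (\<Sum>j\<in>UNIV. dist (d j) (x $ j))"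
      by (simp add: dist_vec_def L2_set_le_sum)
    also have "\<dots> \<le> (\<Sum>j\<in>(UNIV :: 'q set). \<delta>)"
      using d(2) by (intro sum_mono less_imp_le)
    also have "\<dots> < e"
      using \<open>e > 0\<close> by (simp add: \<delta>_def)
    finally show "\<exists>y\<in>X. dist y x < e"
      using d(1) by (auto simp: X_def)
  qed
  moreover have "countable X"
    unfolding X_def by (intro countable_image countable_PiE D(1)) simp
  ultimately show ?thesis
    unfolding separable_set_def by (intro exI[of _ X]) auto
qed

section \<open>The class \<open>B\<^sub>1\<^sup>*(\<Omega>)\<close>\<close>

lemma B_star_bounded_op: "B_star m \<Omega> UNIV M \<Longrightarrow> bounded_op UNIV (M i)"
  by (simp add: B_star_def hilbert_module_def)

lemma column_op_UNIV:
  assumes "B_star m \<Omega> UNIV M"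
  shows "column_op UNIV M w h = (\<chi> i. hadjoint UNIV (M i) h - cnj (w $ i) *\<^sub>C h)"
  by (simp add: column_op_def hadjoint_diff_scaleC[OF B_star_bounded_op[OF assms]])

lemma eigen_bundle_UNIV:
  assumes "B_star m \<Omega> UNIV M"
  shows "eigen_bundle UNIV M w = {h. \<forall>i. hadjoint UNIV (M i) h = cnj (w $ i) *\<^sub>C h}"
  by (simp add: eigen_bundle_def hadjoint_diff_scaleC[OF B_star_bounded_op[OF assms]])

lemma csubspace_eigen_bundle_UNIV:
  assumes "B_star m \<Omega> UNIV M"
  shows "cvec.subspace (eigen_bundle UNIV M w)"
proof -
  have "bounded_op UNIV (hadjoint UNIV (M i))" for i
    by (intro bounded_op_hadjoint B_star_bounded_op[OF assms])
  then have L: "bounded_linear (hadjoint UNIV (M i))"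
    "hadjoint UNIV (M i) (a *\<^sub>C x) = a *\<^sub>C hadjoint UNIV (M i) x" for i a x
    unfolding bounded_op_UNIV_iff by blast+
  show ?thesis
    unfolding eigen_bundle_UNIV[OF assms]
    by (auto simp: cvec.subspace_def linear_simps[OF L(1)] L(2) cvec.scale_right_distrib
        scaleC_scaleC mult.commute)
qed

lemma B_star_1_fiber:
  assumes H: "B_star 1 \<Omega> UNIV M" and "w \<in> \<Omega>"
  shows "\<exists>k. k \<noteq> 0 \<and> eigen_bundle UNIV M w = cvec.span {k}"
proof -
  have "cvec.dim (eigen_bundle UNIV M w) = 1"
    using assms by (simp add: B_star_def)
  then obtain B where B: "B \<subseteq> eigen_bundle UNIV M w" "cvec.independent B"
    "eigen_bundle UNIV M w \<subseteq> cvec.span B" "card B = 1"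
    using cvec.basis_exists[of "eigen_bundle UNIV M w"] by metis
  then obtain k where k: "B = {k}"
    using card_1_singletonE by blast
  then have "k \<noteq> 0"
    using B(2) by auto
  moreover have "eigen_bundle UNIV M w = cvec.span {k}"
    using B(1,3) cvec.span_minimal[OF _ csubspace_eigen_bundle_UNIV[OF H]] unfolding k by blast
  ultimately show ?thesis by blast
qed

text \<open>The local kernel section never vanishes, so in one-dimensional fibers it is itself a
  local frame.\<close>

lemma antiholomorphic_bundle_eigen_bundle:
  fixes M :: "'n::finite \<Rightarrow> 'h::chilbert_space \<Rightarrow> 'h"
  assumes "open \<Omega>" and H: "B_star 1 \<Omega> UNIV M"
  shows "antiholomorphic_bundle 1 \<Omega> (eigen_bundle UNIV M)"
  unfolding antiholomorphic_bundle_def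
proof (intro conjI ballI)
  show "cvec.subspace (eigen_bundle UNIV M w)" for w
    by (rule csubspace_eigen_bundle_UNIV[OF H])
  fix w0 assume w0: "w0 \<in> \<Omega>"
  let ?A = "\<lambda>w h. \<chi> i. hadjoint UNIV (M i) h - cnj (w $ i) *\<^sub>C h"
  have E: "{h. ?A w h = 0} = eigen_bundle UNIV M w" for w
    by (auto simp: eigen_bundle_UNIV[OF H] vec_eq_iff)
  have "\<exists>U s. open U \<and> w0 \<in> U \<and> U \<subseteq> \<Omega> \<and> antiholomorphic_map U s \<and>
    (\<forall>w\<in>U. s w \<noteq> 0 \<and> ?A w (s w) = 0)"
  proof (rule local_antiholomorphic_kernel_section[OF _ \<open>open \<Omega>\<close> w0])
    show "bounded_op UNIV (hadjoint UNIV (M i))" for i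
      by (intro bounded_op_hadjoint B_star_bounded_op[OF H])
    fix w assume w: "w \<in> \<Omega>"
    have "closed (range (column_op UNIV M w))"
      using H w by (simp add: B_star_def)
    then show "closed (range (?A w))"
      by (simp add: column_op_UNIV[OF H, abs_def])
    show "\<exists>k. k \<noteq> 0 \<and> {h. ?A w h = 0} = cvec.span {k}"
      unfolding E by (rule B_star_1_fiber[OF H w])
  qed
  then obtain U s where U: "open U" "w0 \<in> U" "U \<subseteq> \<Omega>" "antiholomorphic_map U s"
    and s: "\<forall>w\<in>U. s w \<noteq> 0 \<and> ?A w (s w) = 0"
    by (elim exE conjE)
  have mem: "s w \<in> eigen_bundle UNIV M w" if "w \<in> U" for w
    using s that unfolding E[symmetric] by simp
  have span: "cvec.span {s w} = eigen_bundle UNIV M w" if w: "w \<in> U" for w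
  proof -
    obtain k where k: "k \<noteq> 0" "eigen_bundle UNIV M w = cvec.span {k}"
      using B_star_1_fiber[OF H subsetD[OF U(3) w]] by (elim exE conjE)
    obtain a where a: "s w = a *\<^sub>C k"
      using mem[OF w] unfolding k(2) cvec.span_singleton by (rule imageE)
    have "a \<noteq> 0"
      using s w a by auto
    then have "k = (1 / a) *\<^sub>C s w"
      by (simp add: a scaleC_scaleC scaleC_one)
    then have "k \<in> cvec.span {s w}"
      by (metis cvec.span_base cvec.span_scale singletonI)
    then have "cvec.span {k} \<subseteq> cvec.span {s w}"
      by (intro cvec.span_minimal cvec.subspace_span) simp
    moreover have "cvec.span {s w} \<subseteq> cvec.span {k}"
      using mem[OF w] unfolding k(2) by (intro cvec.span_minimal cvec.subspace_span) simp
    ultimately show ?thesis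
      unfolding k(2) by (intro equalityI)
  qed
  have one: "{..<Suc 0} = {0}" by auto
  show "\<exists>U s. open U \<and> w0 \<in> U \<and> U \<subseteq> \<Omega> \<and>
      (\<forall>j<1. antiholomorphic_section U (eigen_bundle UNIV M) (s j)) \<and>
      (\<forall>w\<in>U. inj_on (\<lambda>j. s j w) {..<1::nat} \<and> cvec.independent ((\<lambda>j. s j w) ` {..<1}) \<and>
        cvec.span ((\<lambda>j. s j w) ` {..<1}) = eigen_bundle UNIV M w)"
    using U s mem span
    by (intro exI[of _ U] exI[of _ "\<lambda>_. s"]) (simp add: one antiholomorphic_section_def)
qed

text \<open>Each \<open>x\<close> is the sum of its coordinates tensored with the standard basis.
  For a fixed basis vector, the \<open>h\<close> whose tensor lies in \<open>W\<close> form a closed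
  subspace containing all fibers, hence all of \<open>H\<close> by condition (iii) of the
  class.\<close>

lemma tensors_total:
  fixes M :: "'n::finite \<Rightarrow> 'h::chilbert_space \<Rightarrow> 'h" and W :: "('h ^ 'q) set"
  assumes H: "B_star 1 \<Omega> UNIV M" and W: "cvec.subspace W" "closed W"
    and mem: "\<And>w k \<eta>. w \<in> \<Omega> \<Longrightarrow> k \<in> eigen_bundle UNIV M w \<Longrightarrow> k \<otimes> \<eta> \<in> W"
  shows "x \<in> W"
proof -
  have "h \<otimes> axis j 1 \<in> W" for h :: 'h and j :: 'q
  proof -
    let ?X = "{h. h \<otimes> axis j (1::complex) \<in> W}"
    have "cvec.subspace ?X"
      using cvec.subspace_0[OF W(1)] cvec.subspace_add[OF W(1)] cvec.subspace_scale[OF W(1)]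
      by (auto simp: cvec.subspace_def tensor_add_left tensor_scaleC_left tensor_eq_0_iff[THEN iffD2])
    moreover have "(\<Union>w\<in>\<Omega>. eigen_bundle UNIV M w) \<subseteq> ?X"
      using mem by blast
    ultimately have "cvec.span (\<Union>w\<in>\<Omega>. eigen_bundle UNIV M w) \<subseteq> ?X"
      by (intro cvec.span_minimal)
    moreover have "closed ?X"
    proof -
      have "continuous_on UNIV (\<lambda>h :: 'h. h \<otimes> axis j (1::complex))"
        by (rule bounded_linear.continuous_on[OF bounded_bilinear.bounded_linear_left[OF bounded_bilinear_tensor]])
          (rule continuous_on_id)
      then have "closed ((\<lambda>h. h \<otimes> axis j (1::complex)) -` W)"
        by (rule closed_vimage[OF W(2)])
      then show ?thesis by (simp add: vimage_def)
    qed
    ultimately have "closure (cvec.span (\<Union>w\<in>\<Omega>. eigen_bundle UNIV M w)) \<subseteq> ?X"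
      by (intro closure_minimal)
    then show ?thesis
      using H by (auto simp: B_star_def)
  qed
  then have "(\<Sum>j\<in>UNIV. (x $ j) \<otimes> axis j 1) \<in> W"
    by (intro cvec.subspace_sum[OF W(1)])
  also have "(\<Sum>j\<in>UNIV. (x $ j) \<otimes> axis j 1) = x"
    by (simp add: vec_eq_iff tensor_def axis_def if_distrib[of "\<lambda>a. a *\<^sub>C _"] scaleC_one cong: if_cong)
  finally show ?thesis .
qed

lemma bounded_op_eq_on_tensors:
  fixes M :: "'n::finite \<Rightarrow> 'h::chilbert_space \<Rightarrow> 'h" and f g :: "'h ^ 'q \<Rightarrow> 'b::complex_inner"
  assumes H: "B_star 1 \<Omega> UNIV M" and f: "bounded_op UNIV f" and g: "bounded_op UNIV g"
    and eq: "\<And>w k \<eta>. w \<in> \<Omega> \<Longrightarrow> k \<in> eigen_bundle UNIV M w \<Longrightarrow> f (k \<otimes> \<eta>) = g (k \<otimes> \<eta>)"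
  shows "f x = g x"
proof -
  have bl: "bounded_linear f" "bounded_linear g"
    and sc: "\<And>a x. f (a *\<^sub>C x) = a *\<^sub>C f x" "\<And>a x. g (a *\<^sub>C x) = a *\<^sub>C g x"
    using f g by (auto simp: bounded_op_UNIV_iff)
  have "x \<in> {x. f x = g x}"
  proof (rule tensors_total[OF H])
    show "cvec.subspace {x. f x = g x}"
      by (auto simp: cvec.subspace_def linear_simps[OF bl(1)] linear_simps[OF bl(2)] sc)
    show "closed {x. f x = g x}"
      using bl by (intro closed_Collect_eq) (auto intro: linear_continuous_on)
  qed (simp add: eq)
  then show ?thesis by simp
qed

lemma hadjoint_mult_op:
  assumes "is_mult_op \<Omega> M \<Theta> T" "w \<in> \<Omega>" "k \<in> eigen_bundle UNIV M w"
  shows "hadjoint UNIV T (k \<otimes> \<eta>) = k \<otimes> (cadj (\<Theta> w) *v \<eta>)"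
  using assms by (simp add: is_mult_op_def hadjoint_matrix_vector_mult)

text \<open>The defining formula fixes the adjoint on a total set of tensors, hence everywhere, and
  thereby the operator. This makes the definite description in \<open>mult_op\<close>
  meaningful.\<close>

lemma mult_op_eq:
  assumes H: "B_star 1 \<Omega> UNIV M" and T: "is_mult_op \<Omega> M \<Theta> T"
  shows "mult_op \<Omega> M \<Theta> = T"
  unfolding mult_op_def
proof (rule the_equality[where P = "is_mult_op \<Omega> M \<Theta>", OF T])
  fix T' assume T': "is_mult_op \<Omega> M \<Theta> T'"
  have bd: "bounded_op UNIV T" "bounded_op UNIV T'"
    using T T' by (auto simp: is_mult_op_def)
  have "hadjoint UNIV T' y = hadjoint UNIV T y" for y
    by (rule bounded_op_eq_on_tensors[OF H bounded_op_hadjoint[OF bd(2)] bounded_op_hadjoint[OF bd(1)]])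
      (simp add: hadjoint_mult_op[OF T] hadjoint_mult_op[OF T'])
  then have eq: "cinner y (T' x) = cinner y (T x)" for x y
    using cinner_hadjoint[OF bd(1), of x y] cinner_hadjoint[OF bd(2), of x y]
    by (metis cinner_commute)
  show "T' = T"
    by (rule ext, rule cinner_ext, rule eq)
qed

section \<open>The canonical model\<close>

text \<open>Fixes the left inverse together with concrete operators for both multipliers, so that
  the argument runs without definite descriptions of \<open>mult_op\<close>.\<close>

locale canonical_model =
  fixes \<Omega> :: "(complex ^ 'n) set"
    and M :: "'n::finite \<Rightarrow> 'h::chilbert_space \<Rightarrow> 'h"
    and \<Theta> :: "complex ^ 'n \<Rightarrow> complex ^ 'p ^ 'q"
    and \<Psi> :: "complex ^ 'n \<Rightarrow> complex ^ 'q ^ 'p"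
    and T :: "'h ^ 'p \<Rightarrow> 'h ^ 'q" and R :: "'h ^ 'q \<Rightarrow> 'h ^ 'p"
  assumes open_\<Omega>: "open \<Omega>" and H: "B_star 1 \<Omega> UNIV M"
    and hol: "holomorphic_map \<Omega> \<Theta>" "holomorphic_map \<Omega> \<Psi>"
    and T: "is_mult_op \<Omega> M \<Theta> T" and R: "is_mult_op \<Omega> M \<Psi> R"
    and left_inverse: "\<And>w. w \<in> \<Omega> \<Longrightarrow> \<Psi> w ** \<Theta> w = mat 1"
begin

definition Mad where "Mad i = hadjoint UNIV (M i)"
definition Tad where "Tad = hadjoint UNIV T"
definition Rad where "Rad = hadjoint UNIV R"
definition S where "S = orth (range T)"
definition N where "N i x = orth_proj S (ampliation (M i) x)"

text \<open>A generally non-orthogonal idempotent with range \<open>S\<close>.\<close>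

definition Q where "Q x = x - Rad (Tad x)"

lemma bounded_op_adjoints:
  "bounded_op UNIV (M i)" "bounded_op UNIV (Mad i)" "bounded_op UNIV Tad" "bounded_op UNIV Rad"
  using B_star_bounded_op[OF H] T R
  by (auto simp: Mad_def Tad_def Rad_def is_mult_op_def intro: bounded_op_hadjoint)

lemma bounded_linear_adjoints: "bounded_linear (Mad i)" "bounded_linear Tad" "bounded_linear Rad"
  and scaleC_adjoints: "Mad i (a *\<^sub>C h) = a *\<^sub>C Mad i h" "Tad (a *\<^sub>C x) = a *\<^sub>C Tad x"
    "Rad (a *\<^sub>C y) = a *\<^sub>C Rad y"
  using bounded_op_adjoints by (auto simp: bounded_op_UNIV_iff)

lemmas adjoint_simps = linear_simps[OF bounded_linear_adjoints(1)]
  linear_simps[OF bounded_linear_adjoints(2)] linear_simps[OF bounded_linear_adjoints(3)]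

lemma cinner_T: "cinner (T x) y = cinner x (Tad y)"
  and cinner_R: "cinner (R y) x = cinner y (Rad x)"
  using T R unfolding is_mult_op_def by (auto simp: Tad_def Rad_def intro: cinner_hadjoint)

lemma cinner_ampliation_M: "cinner (ampliation (M i) x) y = cinner x (ampliation (Mad i) y)"
  unfolding Mad_def by (rule cinner_ampliation[OF bounded_op_adjoints(1)])

text \<open>Both sides are adjoints of composites that agree because \<open>T\<close> is a module
  map.\<close>

lemma Tad_ampliation: "Tad (ampliation (Mad i) y) = ampliation (Mad i) (Tad y)"
  by (rule cinner_ext)
    (use T in \<open>simp flip: cinner_T cinner_ampliation_M add: is_mult_op_def\<close>)

lemma Rad_ampliation: "Rad (ampliation (Mad i) y) = ampliation (Mad i) (Rad y)"
  by (rule cinner_ext)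
    (use R in \<open>simp flip: cinner_R cinner_ampliation_M add: is_mult_op_def\<close>)

lemma Tad_tensor: "w \<in> \<Omega> \<Longrightarrow> k \<in> eigen_bundle UNIV M w \<Longrightarrow> Tad (k \<otimes> \<eta>) = k \<otimes> (cadj (\<Theta> w) *v \<eta>)"
  and Rad_tensor: "w \<in> \<Omega> \<Longrightarrow> k \<in> eigen_bundle UNIV M w \<Longrightarrow> Rad (k \<otimes> \<xi>) = k \<otimes> (cadj (\<Psi> w) *v \<xi>)"
  unfolding Tad_def Rad_def by (simp_all add: hadjoint_mult_op[OF T] hadjoint_mult_op[OF R])

lemma cadj_left_inverse: "w \<in> \<Omega> \<Longrightarrow> cadj (\<Theta> w) ** cadj (\<Psi> w) = mat 1"
  by (simp add: left_inverse cadj_mat_1 flip: cadj_matrix_mult)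

text \<open>On \<open>k \<otimes> \<eta>\<close> the composite acts by the adjoint of
  \<open>\<Psi> w ** \<Theta> w\<close>, which is the identity; totality of these tensors does the
  rest. This identity is what makes \<open>Q\<close> an idempotent.\<close>

lemma Tad_Rad: "Tad (Rad x) = x"
proof (rule bounded_op_eq_on_tensors[OF H])
  show "bounded_op UNIV (\<lambda>x. Tad (Rad x))"
    unfolding bounded_op_UNIV_iff
    by (auto intro: bounded_linear_compose bounded_linear_adjoints simp: scaleC_adjoints)
  show "bounded_op UNIV (\<lambda>x. x)"
    by (simp add: bounded_op_UNIV_iff)
qed (simp add: Rad_tensor Tad_tensor matrix_vector_mul_assoc cadj_left_inverse)

lemma S_eq: "S = {x. Tad x = 0}"
proof -
  have "(\<forall>z. cinner x (T z) = 0) \<longleftrightarrow> (\<forall>z. cinner z (Tad x) = 0)" for x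
    by (metis cinner_commute cinner_T complex_cnj_zero)
  also have "(\<forall>z. cinner z (Tad x) = 0) \<longleftrightarrow> Tad x = 0" for x
    by (metis cinner_eq_zero_iff cinner_zero_right)
  finally show ?thesis
    by (auto simp: S_def orth_def)
qed

lemma csubspace_S: "cvec.subspace S" and closed_S: "closed S"
  by (simp_all add: S_def csubspace_orth closed_orth)

lemma Q_in_S: "Q x \<in> S"
  by (simp add: S_eq Q_def adjoint_simps Tad_Rad)

lemma Q_ident: "x \<in> S \<Longrightarrow> Q x = x"
  by (simp add: S_eq Q_def adjoint_simps)

lemma bounded_linear_Q: "bounded_linear Q"
  unfolding Q_def
  by (intro bounded_linear_sub bounded_linear_ident
      bounded_linear_compose[OF bounded_linear_adjoints(3) bounded_linear_adjoints(2)])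

lemma Q_scaleC: "Q (a *\<^sub>C x) = a *\<^sub>C Q x"
  by (simp add: Q_def scaleC_adjoints cvec.scale_right_diff_distrib)

lemma ampliation_zero: "ampliation (Mad i) 0 = 0"
  by (simp add: ampliation_def vec_eq_iff adjoint_simps)

lemma ampliation_S: "x \<in> S \<Longrightarrow> ampliation (Mad i) x \<in> S"
  by (simp add: S_eq Tad_ampliation ampliation_zero)

lemma N_in_S: "N i x \<in> S"
  unfolding N_def by (rule orth_proj_properties(1)[OF csubspace_S closed_S])

section \<open>Compressed operators and the defining conditions of the class\<close>

lemma cinner_N: "h \<in> S \<Longrightarrow> cinner (N i x) h = cinner x (ampliation (Mad i) h)"
  by (simp add: N_def cinner_orth_proj[OF csubspace_S closed_S] cinner_ampliation_M)

text \<open>\<open>S\<close> is invariant under the adjoints of the ampliated tuple, so the adjoint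
  of a compression is a mere restriction and no projection appears.\<close>

lemma hadjoint_N:
  assumes "h \<in> S"
  shows "hadjoint S (\<lambda>x. N i x - a *\<^sub>C x) h = ampliation (Mad i) h - cnj a *\<^sub>C h"
proof (rule hadjoint_eqI[OF csubspace_S])
  show "ampliation (Mad i) h - cnj a *\<^sub>C h \<in> S"
    by (intro cvec.subspace_diff cvec.subspace_scale csubspace_S ampliation_S assms)
qed (simp add: cinner_diff_left cinner_diff_right cinner_scaleC_left cinner_scaleC_right cinner_N assms)

lemma Mad_commute: "Mad i (Mad j h) = Mad j (Mad i h)"
proof (rule cinner_ext)
  have ad: "cinner (M i x) h = cinner x (Mad i h)" for i x h
    unfolding Mad_def by (rule cinner_hadjoint[OF bounded_op_adjoints(1)])
  have "M j (M i x) = M i (M j x)" for x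
    using H by (simp add: B_star_def hilbert_module_def)
  then show "cinner x (Mad i (Mad j h)) = cinner x (Mad j (Mad i h))" for x
    unfolding ad[symmetric] by simp
qed

lemma hilbert_module_S: "hilbert_module S N"
  unfolding hilbert_module_def
proof (intro conjI allI ballI csubspace_S closed_S)
  have "separable_set (UNIV :: ('h ^ 'q) set)"
    using H by (intro separable_vec) (simp add: B_star_def hilbert_module_def)
  then obtain D :: "('h ^ 'q) set" where D: "countable D" "closure D = UNIV"
    by (auto simp: separable_set_def)
  \<comment> \<open>\<open>Q\<close> is bounded, maps into \<open>S\<close> and fixes it, so it
    carries a dense set of the whole space to a dense set of \<open>S\<close>.\<close>
  have "S \<subseteq> Q ` closure D"
    unfolding D(2) using Q_ident by (metis UNIV_I image_eqI subsetI)
  also have "\<dots> \<subseteq> closure (Q ` D)"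
    by (rule closure_bounded_linear_image_subset[OF bounded_linear_Q])
  finally show "separable_set S"
    unfolding separable_set_def using D(1) Q_in_S by (intro exI[of _ "Q ` D"]) auto
next
  fix i j
  show "N i ` S \<subseteq> S"
    using N_in_S by blast
  have "bounded_op UNIV (orth_proj S)" "bounded_op UNIV (ampliation (M i) :: 'h ^ 'q \<Rightarrow> _)"
    by (intro bounded_op_orth_proj csubspace_S closed_S bounded_op_ampliation bounded_op_adjoints)+
  then have "bounded_op UNIV (N i)"
    unfolding bounded_op_UNIV_iff N_def by (auto intro: bounded_linear_compose)
  then show "bounded_op S (N i)"
    by (rule bounded_op_subset)
  fix x assume "x \<in> S"
  \<comment> \<open>The commutator lies in \<open>S\<close>; pairing it with itself moves both
    operators to the adjoint side, where they commute.\<close>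
  let ?d = "N i (N j x) - N j (N i x)"
  have d: "?d \<in> S"
    by (intro cvec.subspace_diff csubspace_S N_in_S)
  have "cinner ?d ?d = cinner x (ampliation (Mad j) (ampliation (Mad i) ?d)) -
      cinner x (ampliation (Mad i) (ampliation (Mad j) ?d))"
    unfolding cinner_diff_left[of "N i (N j x)"] cinner_N[OF d] cinner_N[OF ampliation_S[OF d]] ..
  also have "\<dots> = 0"
    by (simp add: ampliation_def Mad_commute[of i j])
  finally show "N i (N j x) = N j (N i x)" by simp
qed

lemma column_op_S: "h \<in> S \<Longrightarrow> column_op S N w h = (\<chi> i. ampliation (Mad i) h - cnj (w $ i) *\<^sub>C h)"
  by (simp add: column_op_def hadjoint_N)

text \<open>
  A preimage under the ampliated column operator exists in \<open>H \<otimes> \<complex>\<^sup>q\<close> by closedness of the range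
  for \<open>H\<close>; it is moved into \<open>S\<close> by \<open>Q\<close>, which commutes with the adjoints.
\<close>

lemma closed_column_op:
  assumes w: "w \<in> \<Omega>"
  shows "closed (column_op S N w ` S)"
  unfolding closed_sequential_limits
proof (intro allI impI, elim conjE)
  fix y l assume "\<forall>n. y n \<in> column_op S N w ` S" and lim: "y \<longlonglongrightarrow> l"
  then have "\<forall>n. \<exists>s. s \<in> S \<and> y n = column_op S N w s"
    by (auto simp: image_iff)
  then obtain s where s: "\<forall>n. s n \<in> S \<and> y n = column_op S N w (s n)"
    unfolding choice_iff ..
  define L where "L i x = ampliation (Mad i) x - cnj (w $ i) *\<^sub>C x" for i and x :: "'h ^ 'q"
  have y: "y n $ i = L i (s n)" for n i
    using s by (simp add: column_op_S L_def)
  have lim_i: "(\<lambda>n. L i (s n)) \<longlonglongrightarrow> l $ i" for i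
    using tendsto_vec_nth[OF lim, of i] by (simp add: y)
  \<comment> \<open>The kernel of \<open>Tad\<close> is closed and contains all approximants, so it
    contains the components of the limit; the correction by \<open>Q\<close> below relies on
    this.\<close>
  have "Tad (L i (s n)) = 0" for i n
    using s by (simp add: L_def adjoint_simps scaleC_adjoints Tad_ampliation S_eq ampliation_zero)
  then have "(\<lambda>n. 0) \<longlonglongrightarrow> Tad (l $ i)" for i
    using bounded_linear.tendsto[OF bounded_linear_adjoints(2) lim_i[of i]] by simp
  then have Tl: "Tad (l $ i) = 0" for i
    using LIMSEQ_unique tendsto_const by blast
  \<comment> \<open>The closed range for \<open>H\<close> is used separately in each coordinate
    \<open>j\<close> of \<open>\<complex>\<^sup>q\<close>.\<close>
  have "\<exists>h. column_op UNIV M w h = (\<chi> i. l $ i $ j)" for j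
  proof -
    have cl: "closed (range (column_op UNIV M w))"
      using H w by (simp add: B_star_def)
    have "(\<lambda>n. \<chi> i. L i (s n) $ j) \<longlonglongrightarrow> (\<chi> i. l $ i $ j)"
      by (intro tendsto_vec_lambda tendsto_vec_nth lim_i)
    moreover have "(\<chi> i. L i (s n) $ j) = column_op UNIV M w (s n $ j)" for n
      by (simp add: column_op_UNIV[OF H] L_def ampliation_def Mad_def scaleC_vec_def)
    ultimately have "(\<lambda>n. column_op UNIV M w (s n $ j)) \<longlonglongrightarrow> (\<chi> i. l $ i $ j)"
      by simp
    then have "(\<chi> i. l $ i $ j) \<in> range (column_op UNIV M w)"
      by (rule closed_sequentially[OF cl, rotated]) simp
    then show ?thesis by (metis imageE)
  qed
  then obtain h where h: "\<And>j. column_op UNIV M w (h j) = (\<chi> i. l $ i $ j)"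
    by metis
  define x where "x = (\<chi> j. h j)"
  have Lx: "L i x = l $ i" for i
  proof -
    have "L i x $ j = column_op UNIV M w (h j) $ i" for j
      by (simp add: column_op_UNIV[OF H] L_def x_def ampliation_def Mad_def scaleC_vec_def)
    then show ?thesis
      by (simp add: h vec_eq_iff)
  qed
  have "L i (Q x) = l $ i" for i
  proof -
    \<comment> \<open>Because \<open>L i\<close> commutes with \<open>Q\<close>, passing from
      \<open>x\<close> to \<open>Q x\<close> changes the value only by
      \<open>Rad (Tad (l $ i))\<close>, which is zero.\<close>
    have "L i (Q x) = L i x - Rad (Tad (L i x))"
      by (simp add: L_def Q_def adjoint_simps scaleC_adjoints Tad_ampliation Rad_ampliation
          cvec.scale_right_diff_distrib)
        (simp add: ampliation_def adjoint_simps vec_eq_iff)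
    then show ?thesis
      by (simp add: Lx Tl adjoint_simps)
  qed
  then have "column_op S N w (Q x) = l"
    by (simp add: column_op_S[OF Q_in_S] vec_eq_iff flip: L_def)
  then show "l \<in> column_op S N w ` S"
    using Q_in_S by blast
qed

text \<open>The eigenvalue equations can be read coordinatewise: every coordinate of
  \<open>h\<close> is a multiple of the spanning vector \<open>k\<close>, so \<open>h\<close> is
  \<open>k\<close> tensored with a vector \<open>a\<close>. Membership in \<open>S\<close> then
  becomes \<open>k \<otimes> (cadj (\<Theta> w) *v a) = 0\<close>, that is, \<open>a\<close> lies in
  the fiber of \<open>V_bundle\<close>.\<close>

lemma eigen_bundle_S:
  assumes w: "w \<in> \<Omega>"
  shows "eigen_bundle S N w = tensor_bundle (eigen_bundle UNIV M) (V_bundle \<Theta>) w"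
proof -
  obtain k where k: "k \<noteq> 0" "eigen_bundle UNIV M w = cvec.span {k}"
    using B_star_1_fiber[OF H w] by blast
  have kE: "k \<in> eigen_bundle UNIV M w"
    by (simp add: k(2) cvec.span_base)
  have "cvec.subspace (V_bundle \<Theta> w)"
    by (simp add: V_bundle_def csubspace_orth)
  then have "tensor_bundle (eigen_bundle UNIV M) (V_bundle \<Theta>) w = (\<lambda>x. k \<otimes> x) ` V_bundle \<Theta> w"
    by (rule tensor_bundle_line[of "eigen_bundle UNIV M", OF k(2)])
  moreover have "eigen_bundle S N w = {h \<in> S. \<forall>j. h $ j \<in> eigen_bundle UNIV M w}"
  proof -
    have "eigen_bundle S N w = {h \<in> S. \<forall>i. ampliation (Mad i) h = cnj (w $ i) *\<^sub>C h}"
      by (auto simp: eigen_bundle_def[of S] hadjoint_N)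
    then show ?thesis
      by (auto simp: eigen_bundle_UNIV[OF H] ampliation_def vec_eq_iff scaleC_vec_def Mad_def)
  qed
  moreover have "{h \<in> S. \<forall>j. h $ j \<in> eigen_bundle UNIV M w} = (\<lambda>x. k \<otimes> x) ` V_bundle \<Theta> w"
  proof (intro equalityI subsetI)
    fix h assume h: "h \<in> {h \<in> S. \<forall>j. h $ j \<in> eigen_bundle UNIV M w}"
    then have "\<forall>j. \<exists>a. h $ j = a *\<^sub>C k"
      unfolding k(2) cvec.span_singleton by blast
    then obtain a where a: "\<And>j. h $ j = a j *\<^sub>C k" by metis
    have h_eq: "h = k \<otimes> (\<chi> j. a j)"
      by (simp add: tensor_def vec_eq_iff a)
    have "k \<otimes> (cadj (\<Theta> w) *v (\<chi> j. a j)) = 0"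
      using h by (simp add: S_eq h_eq flip: Tad_tensor[OF w kE])
    then have "(\<chi> j. a j) \<in> V_bundle \<Theta> w"
      using k(1) by (simp add: tensor_eq_0_iff V_bundle_eq)
    then show "h \<in> (\<lambda>x. k \<otimes> x) ` V_bundle \<Theta> w"
      using h_eq by blast
  next
    fix h assume "h \<in> (\<lambda>x. k \<otimes> x) ` V_bundle \<Theta> w"
    then obtain x where x: "h = k \<otimes> x" "cadj (\<Theta> w) *v x = 0"
      by (auto simp: V_bundle_eq)
    have "h $ j \<in> eigen_bundle UNIV M w" for j
      by (simp add: x(1) tensor_def cvec.subspace_scale[OF csubspace_eigen_bundle_UNIV[OF H] kE])
    moreover have "h \<in> S"
      by (simp add: S_eq x Tad_tensor[OF w kE] tensor_eq_0_iff)
    ultimately show "h \<in> {h \<in> S. \<forall>j. h $ j \<in> eigen_bundle UNIV M w}" by blast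
  qed
  ultimately show ?thesis by simp
qed

lemma antiholomorphic_bundle_V: "antiholomorphic_bundle (CARD('q) - CARD('p)) \<Omega> (V_bundle \<Theta>)"
  by (rule antiholomorphic_bundle_V_bundle[OF open_\<Omega> hol left_inverse])

lemma antiholomorphic_bundle_S:
  "antiholomorphic_bundle (CARD('q) - CARD('p)) \<Omega> (tensor_bundle (eigen_bundle UNIV M) (V_bundle \<Theta>))"
  by (rule antiholomorphic_bundle_tensor[OF antiholomorphic_bundle_eigen_bundle[OF open_\<Omega> H]
        antiholomorphic_bundle_V])

text \<open>\<open>Q\<close> sends an eigenvector tensor over \<open>w\<close> into the fiber of the
  model at \<open>w\<close>. The preimage under \<open>Q\<close> of the closed span is thus a closed
  subspace containing a total set, hence everything, and \<open>Q\<close> is the identity on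
  \<open>S\<close>.\<close>

lemma closure_span_eigen_bundle: "closure (cvec.span (\<Union>w\<in>\<Omega>. eigen_bundle S N w)) = S"
proof (rule antisym)
  let ?W = "closure (cvec.span (\<Union>w\<in>\<Omega>. eigen_bundle S N w))"
  show "?W \<subseteq> S"
    by (intro closure_minimal cvec.span_minimal csubspace_S closed_S) (auto simp: eigen_bundle_def)
  have W: "cvec.subspace ?W"
    by (intro csubspace_closure cvec.subspace_span)
  have "x \<in> {x. Q x \<in> ?W}" for x
  proof (rule tensors_total[OF H])
    show "cvec.subspace {x. Q x \<in> ?W}"
      using cvec.subspace_0[OF W] cvec.subspace_add[OF W] cvec.subspace_scale[OF W]
      by (simp add: cvec.subspace_def linear_simps[OF bounded_linear_Q] Q_scaleC)
    have "closed (Q -` ?W)"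
      using bounded_linear_Q by (intro closed_vimage closed_closure) (auto intro: linear_continuous_on)
    then show "closed {x. Q x \<in> ?W}"
      by (simp add: vimage_def)
    fix w k \<eta> assume w: "w \<in> \<Omega>" and k: "k \<in> eigen_bundle UNIV M w"
    let ?x = "\<eta> - cadj (\<Psi> w) *v (cadj (\<Theta> w) *v \<eta>)"
    have "Q (k \<otimes> \<eta>) = k \<otimes> ?x"
      by (simp add: Q_def Tad_tensor[OF w k] Rad_tensor[OF w k] tensor_diff_right)
    moreover have "?x \<in> V_bundle \<Theta> w"
      unfolding V_bundle_eq
      by (simp add: matrix_vector_mult_diff_distrib matrix_vector_mul_assoc[of "cadj (\<Theta> w)" "cadj (\<Psi> w)"]
          cadj_left_inverse[OF w] del: matrix_vector_mul_assoc)
    ultimately have "Q (k \<otimes> \<eta>) \<in> eigen_bundle S N w"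
      unfolding eigen_bundle_S[OF w] tensor_bundle_def using k by (intro cvec.span_base) blast
    then have "Q (k \<otimes> \<eta>) \<in> (\<Union>w\<in>\<Omega>. eigen_bundle S N w)"
      using w by (rule UN_I[rotated])
    then have "Q (k \<otimes> \<eta>) \<in> ?W"
      by (intro subsetD[OF closure_subset] cvec.span_base)
    then show "k \<otimes> \<eta> \<in> {x. Q x \<in> ?W}"
      by simp
  qed
  then have "Q x \<in> ?W" for x
    by simp
  then show "S \<subseteq> ?W"
    using Q_ident by (metis subsetI)
qed

lemma B_star_S:
  assumes "CARD('p) < CARD('q)"
  shows "B_star (CARD('q) - CARD('p)) \<Omega> S N"
  unfolding B_star_def
  \<comment> \<open>The strict inequality of dimensions makes the rank at least 1, and the fiber
    dimension is read off from the local frames.\<close>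
  using assms hilbert_module_S closed_column_op closure_span_eigen_bundle
    dim_antiholomorphic_bundle[OF antiholomorphic_bundle_S]
  by (auto simp: eigen_bundle_S)

end

theorem theorem2p1:
  fixes \<Omega> :: "(complex ^ 'n) set"
    and M :: "'n::finite \<Rightarrow> 'h::chilbert_space \<Rightarrow> 'h"
    and \<Theta> :: "complex ^ 'n \<Rightarrow> complex ^ 'p ^ 'q"
  assumes "open \<Omega>" and "connected \<Omega>" and "\<Omega> \<noteq> {}" and "bounded \<Omega>"
    and "CARD('p) < CARD('q)"
    and "B_star 1 \<Omega> UNIV M"
    and "left_invertible_multiplier \<Omega> M \<Theta>"
  shows "B_star (CARD('q) - CARD('p)) \<Omega> (model_space \<Omega> M \<Theta>) (model_op \<Omega> M \<Theta>) \<and>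
    (\<forall>w\<in>\<Omega>. V_bundle \<Theta> w = {\<eta>. hadjoint UNIV ((*v) (\<Theta> w)) \<eta> = 0}) \<and>
    antiholomorphic_bundle (CARD('q) - CARD('p)) \<Omega> (V_bundle \<Theta>) \<and>
    bundle_iso \<Omega> (eigen_bundle (model_space \<Omega> M \<Theta>) (model_op \<Omega> M \<Theta>))
      (tensor_bundle (eigen_bundle UNIV M) (V_bundle \<Theta>)) \<and>
    (CARD('q) = CARD('p) + 1 \<longrightarrow>
      B_star 1 \<Omega> (model_space \<Omega> M \<Theta>) (model_op \<Omega> M \<Theta>) \<and>
      antiholomorphic_bundle 1 \<Omega> (V_bundle \<Theta>))"
proof -
  obtain \<Psi> :: "complex ^ 'n \<Rightarrow> complex ^ 'q ^ 'p" where
    mult: "multiplier \<Omega> M \<Theta>" "multiplier \<Omega> M \<Psi>" and inv: "\<And>w. w \<in> \<Omega> \<Longrightarrow> \<Psi> w ** \<Theta> w = mat 1"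
    using assms(7) unfolding left_invertible_multiplier_def by blast
  obtain T where T: "is_mult_op \<Omega> M \<Theta> T"
    using mult(1) unfolding multiplier_def by blast
  obtain R where R: "is_mult_op \<Omega> M \<Psi> R"
    using mult(2) unfolding multiplier_def by blast
  interpret canonical_model \<Omega> M \<Theta> \<Psi> T R
    by unfold_locales (use assms mult T R inv in \<open>auto simp: multiplier_def\<close>)
  \<comment> \<open>Uniqueness of the multiplication operator resolves \<open>mult_op\<close> to
    \<open>T\<close>, which identifies the space and operators of the locale with the model.\<close>
  have S: "model_space \<Omega> M \<Theta> = S"
    by (simp add: model_space_def S_def mult_op_eq[OF H T])
  have N: "model_op \<Omega> M \<Theta> = N"
    by (intro ext) (simp add: model_op_def N_def S)
  have B: "B_star (CARD('q) - CARD('p)) \<Omega> S N"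
    by (rule B_star_S[OF assms(5)])
  have iso: "bundle_iso \<Omega> (eigen_bundle S N) (tensor_bundle (eigen_bundle UNIV M) (V_bundle \<Theta>))"
    by (rule bundle_iso_cong[OF antiholomorphic_bundle_S eigen_bundle_S])
  have V: "\<forall>w\<in>\<Omega>. V_bundle \<Theta> w = {\<eta>. hadjoint UNIV ((*v) (\<Theta> w)) \<eta> = 0}"
    by (simp add: V_bundle_eq hadjoint_matrix_vector_mult)
  have one: "CARD('q) - CARD('p) = 1" if "CARD('q) = CARD('p) + 1"
    using that by simp
  show ?thesis
    unfolding S N
  proof (intro conjI impI)
    assume "CARD('q) = CARD('p) + 1"
    note one = one[OF this]
    show "B_star 1 \<Omega> S N" "antiholomorphic_bundle 1 \<Omega> (V_bundle \<Theta>)"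
      using B antiholomorphic_bundle_V unfolding one by blast+
  qed (fact B V antiholomorphic_bundle_V iso)+
qed

end
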